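(* Let $n\ge 1$ and let $u:\mathbb{C}^n\to\mathbb{R}$ be a smooth plurisubharmonic function satisfying, at every point of $\mathbb{C}^n$, the self-shrinking $J$-equation $$-\sum_{i=1}^n\frac{1}{\lambda_i}=\frac{1}{2}\,x\cdot Du-u,$$ where $\lambda_1,\ldots,\lambda_n$ are the eigenvalues of the complex Hessian $\partial\bar\partial u$ at the point, and "$\cdot$" denotes the Euclidean inner product. Then $u$ is a quadratic polynomial.
   Context: Identify $\mathbb{C}^n$ with $\mathbb{R}^{2n}$ via $z_k=x_k+\sqrt{-1}\,y_k$, with real coordinates $(x_1,\ldots,x_n,y_1,\ldots,y_n)$. In the equation, $x$ denotes the position vector in $\mathbb{R}^{2n}$, $Du$ the real gradient of $u$ in $\mathbb{R}^{2n}$, and $x\cdot Du$ their Euclidean inner product in $\mathbb{R}^{2n}$. The complex Hessian is the Hermitian matrix $\partial\bar\partial u=\left(\frac{\partial^2u}{\partial z_i\partial\bar z_j}\right)_{1\le i,j\le n}$ with $\frac{\partial}{\partial z_k}=\frac12\left(\frac{\partial}{\partial x_k}-\sqrt{-1}\frac{\partial}{\partial y_k}\right)$ and $\frac{\partial}{\partial \bar z_k}=\frac12\left(\frac{\partial}{\partial x_k}+\sqrt{-1}\frac{\partial}{\partial y_k}\right)$. Plurisubharmonicity of a smooth function means that $\partial\bar\partial u$ is positive semidefinite everywhere; the equation is understood to include that all $\lambda_i$ are nonzero (hence positive) at every point. "Quadratic polynomial" means a real polynomial of degree at most $2$ in the real coordinates (equivalently, the real Hessian $D^2u$ is constant). 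*)

theory Defs
  imports "HOL-Analysis.Analysis" "HOL-Computational_Algebra.Computational_Algebra"
begin

(* C^n is the type complex ^ 'n (n = CARD('n) \<ge> 1). The library makes it a real Euclidean space of
   dimension 2n whose inner product is the Euclidean one of R^2n and whose standard basis consists
   of axis k 1 (coordinate x_k) and axis k \<i> (coordinate y_k). *)

primrec times_continuously_differentiable ::
  "nat \<Rightarrow> ('a::real_normed_vector \<Rightarrow> 'b::real_normed_vector) \<Rightarrow> bool" where
  "times_continuously_differentiable 0 f \<longleftrightarrow> continuous_on UNIV f"
| "times_continuously_differentiable (Suc k) f \<longleftrightarrow>
     (\<forall>x. f differentiable (at x)) \<and>
     (\<forall>v. times_continuously_differentiable k (\<lambda>x. frechet_derivative f (at x) v))"

definition smooth :: "('a::real_normed_vector \<Rightarrow> 'b::real_normed_vector) \<Rightarrow> bool" where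
  "smooth f \<longleftrightarrow> (\<forall>k. times_continuously_differentiable k f)"

definition gradient :: "('a::euclidean_space \<Rightarrow> real) \<Rightarrow> 'a \<Rightarrow> 'a" where
  "gradient u x = (\<Sum>e\<in>Basis. frechet_derivative u (at x) e *\<^sub>R e)"

(* The Wirtinger operators d/dz_k and d/d(conj z_k) for real-differentiable functions. *)

definition d_z :: "'n \<Rightarrow> (complex ^ 'n \<Rightarrow> complex) \<Rightarrow> complex ^ 'n \<Rightarrow> complex" where
  "d_z k f z = (1 / 2) *
     (frechet_derivative f (at z) (axis k 1) - \<i> * frechet_derivative f (at z) (axis k \<i>))"

definition d_zbar :: "'n \<Rightarrow> (complex ^ 'n \<Rightarrow> complex) \<Rightarrow> complex ^ 'n \<Rightarrow> complex" where
  "d_zbar k f z = (1 / 2) *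
     (frechet_derivative f (at z) (axis k 1) + \<i> * frechet_derivative f (at z) (axis k \<i>))"

definition complex_hessian :: "(complex ^ 'n \<Rightarrow> real) \<Rightarrow> complex ^ 'n \<Rightarrow> complex ^ 'n ^ 'n" where
  "complex_hessian u z = (\<chi> i j. d_z i (d_zbar j (\<lambda>w. complex_of_real (u w))) z)"

definition positive_semidefinite :: "complex ^ 'n ^ 'n \<Rightarrow> bool" where
  "positive_semidefinite A \<longleftrightarrow>
     (\<forall>i j. A $ j $ i = cnj (A $ i $ j)) \<and>
     (\<forall>v :: complex ^ 'n. 0 \<le> Re (\<Sum>i\<in>UNIV. \<Sum>j\<in>UNIV. A $ i $ j * v $ i * cnj (v $ j)))"

(* Intended for smooth u. *)
definition plurisubharmonic :: "(complex ^ 'n \<Rightarrow> real) \<Rightarrow> bool" where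
  "plurisubharmonic u \<longleftrightarrow> (\<forall>z. positive_semidefinite (complex_hessian u z))"

definition charpoly :: "complex ^ 'n ^ 'n \<Rightarrow> complex poly" where
  "charpoly A = det (mat [:0, 1:] - (\<chi> i j. [:A $ i $ j:]))"

(* With algebraic multiplicity, so there are always CARD('n) of them. *)
definition eigenvalues :: "complex ^ 'n ^ 'n \<Rightarrow> complex multiset" where
  "eigenvalues A = proots (charpoly A)"

(* The equation is stated in the complex numbers; for smooth u the Hessian is Hermitian, so its
   eigenvalues are real. They are required to be nonzero because 1 / 0 = 0 in HOL. *)
definition self_shrinking_J_equation :: "(complex ^ 'n \<Rightarrow> real) \<Rightarrow> bool" where
  "self_shrinking_J_equation u \<longleftrightarrow>
     (\<forall>x. (\<forall>\<mu>\<in>#eigenvalues (complex_hessian u x). \<mu> \<noteq> 0) \<and>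
          - (\<Sum>\<mu>\<in>#eigenvalues (complex_hessian u x). 1 / \<mu>) =
          complex_of_real (1 / 2 * (x \<bullet> gradient u x) - u x))"

(* A real polynomial of degree at most 2 in the coordinates x \<bullet> e. *)
definition quadratic_polynomial :: "('a::euclidean_space \<Rightarrow> real) \<Rightarrow> bool" where
  "quadratic_polynomial u \<longleftrightarrow>
     (\<exists>(a :: real) (b :: 'a \<Rightarrow> real) (c :: 'a \<Rightarrow> 'a \<Rightarrow> real). \<forall>x.
        u x = a + (\<Sum>e\<in>Basis. b e * (x \<bullet> e))
                + (\<Sum>e\<in>Basis. \<Sum>f\<in>Basis. c e f * (x \<bullet> e) * (x \<bullet> f)))"

end

(* Put phi = x.Du/2 - u and H = the complex Hessian of u, so that phi = - tr H^-1 <= 0. Differentiating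
   the equation along the radial field gives the drift equation
     tr (H^-2 (complex Hessian of phi)) = x.D phi / 2,
   which has no zeroth order term. Its coefficients satisfy tr H^-2 <= const * phi^2, so on a superlevel
   set of phi they are bounded and |x|^2 is a barrier there; since phi <= 0, phi attains its maximum and
   is constant by the strong maximum principle. Then every second derivative of u is homogeneous of
   degree 0 and smooth at the origin, hence constant. *)

theory Submission
  imports Defs
begin

(* Otherwise every vector component is parsed as a possible power series coefficient as well. *)
no_notation fps_nth (infixl "$" 75)

subsection \<open>A maximum principle for operators with a drift term\<close>

text \<open>The operator has no uniform bounds in either direction. From above its coefficients are
  controlled by the unknown itself, and its ellipticity only by the size of \<open>H\<close>, which
  is merely continuous. Hence the split into a barrier at infinity, which needs only the upper
  bound, and a Hopf argument on compact balls, which also needs the lower one.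

  The zeroth order term is absent because of the factor 1/2: each derivative of x.Du/2 leaves half a
  derivative of u behind, so two of them cancel -u exactly and the complex Hessian of phi is half
  the radial derivative of H.

  The inverse matrix is never differentiated. By concavity of A \<mapsto> - tr A^-1, phi is touched
  from above at each point by an affine expression in the second derivatives of u; equality of the
  radial derivatives at the contact point is the drift equation.

  Taking as directions the rows of H^-1 and their multiples by i turns tr (H^-2 times a complex
  Hessian) into a sum of pure second derivatives, so the maximum principles need only calculus along
  lines.\<close>

lemma second_derivative_test_max:
  fixes g g' :: "real \<Rightarrow> real"
  assumes d: "0 < d"
    and g: "\<And>t. \<bar>t\<bar> < d \<Longrightarrow> (g has_real_derivative g' t) (at t)"
    and g': "(g' has_real_derivative s) (at 0)"
    and max: "\<And>t. \<bar>t\<bar> < d \<Longrightarrow> g t \<le> g 0"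
  shows "g' 0 = 0" "s \<le> 0"
proof -
  show zero: "g' 0 = 0"
    using DERIV_local_max[OF g[of 0] d] max d by auto
  show "s \<le> 0"
  proof (rule ccontr)
    assume "\<not> s \<le> 0"
    then obtain e where e: "0 < e" "\<And>h. 0 < h \<Longrightarrow> h < e \<Longrightarrow> g' 0 < g' (0 + h)"
      using DERIV_pos_inc_right[OF g'] by auto
    define t where "t = min d e / 2"
    have t: "0 < t" "t < d" "t < e" using d e(1) by (auto simp: t_def min_def)
    obtain z where z: "0 < z" "z < t" "g t - g 0 = (t - 0) * g' z"
      using MVT2[of 0 t g g'] t g by auto
    have "0 < g' z" using e(2)[of z] z t zero by auto
    then have "0 < g t - g 0" using z(3) t by simp
    then show False using max[of t] t by simp
  qed
qed

text \<open>Only pure derivatives along lines are recorded: an operator that sums second derivatives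
  in given directions needs no mixed ones, and no linearity in \<open>a\<close> has to be carried
  along. The derivatives at parameter 0 suffice because \<open>x\<close> ranges over all base
  points.\<close>

definition directional_derivatives ::
    "('a::euclidean_space \<Rightarrow> real) \<Rightarrow> ('a \<Rightarrow> 'a \<Rightarrow> real) \<Rightarrow> ('a \<Rightarrow> 'a \<Rightarrow> real) \<Rightarrow> bool" where
  "directional_derivatives f f1 f2 \<longleftrightarrow>
     (\<forall>x a. ((\<lambda>t. f (x + t *\<^sub>R a)) has_real_derivative f1 x a) (at 0) \<and>
            ((\<lambda>t. f1 (x + t *\<^sub>R a) a) has_real_derivative f2 x a) (at 0))"

lemma directional_derivatives_add:
  assumes "directional_derivatives f f1 f2" "directional_derivatives h h1 h2"
  shows "directional_derivatives (\<lambda>x. f x + h x) (\<lambda>x a. f1 x a + h1 x a) (\<lambda>x a. f2 x a + h2 x a)"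
  using assms unfolding directional_derivatives_def by (auto intro: DERIV_add)

lemma directional_derivatives_local_max:
  assumes dd: "directional_derivatives f f1 f2" and r: "0 < r"
    and max: "\<And>y. y \<in> ball p r \<Longrightarrow> f y \<le> f p"
  shows "f1 p a = 0" "f2 p a \<le> 0"
proof -
  define d where "d = r / (norm a + 1)"
  have d: "0 < d" using r by (simp add: d_def add_nonneg_pos)
  have g: "((\<lambda>t. f (p + t *\<^sub>R a)) has_real_derivative f1 (p + t *\<^sub>R a) a) (at t)" for t
  proof -
    have "((\<lambda>s. f ((p + t *\<^sub>R a) + s *\<^sub>R a)) has_real_derivative f1 (p + t *\<^sub>R a) a) (at 0)"
      using dd unfolding directional_derivatives_def by blast
    then have "((\<lambda>s. f (p + (s + t) *\<^sub>R a)) has_real_derivative f1 (p + t *\<^sub>R a) a) (at 0)"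
      by (simp add: algebra_simps)
    then show ?thesis
      using DERIV_shift[of "\<lambda>t. f (p + t *\<^sub>R a)" "f1 (p + t *\<^sub>R a) a" 0 t] by simp
  qed
  have g': "((\<lambda>t. f1 (p + t *\<^sub>R a) a) has_real_derivative f2 p a) (at 0)"
    using dd unfolding directional_derivatives_def by blast
  have m: "f (p + t *\<^sub>R a) \<le> f (p + 0 *\<^sub>R a)" if "\<bar>t\<bar> < d" for t
  proof -
    have "\<bar>t\<bar> * norm a \<le> \<bar>t\<bar> * (norm a + 1)" by (simp add: mult_left_mono)
    also have "\<dots> < r" using that by (simp add: d_def pos_less_divide_eq add_nonneg_pos)
    finally have "p + t *\<^sub>R a \<in> ball p r" by (simp add: dist_norm)
    then show ?thesis using max by simp
  qed
  show "f1 p a = 0" "f2 p a \<le> 0"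
    using second_derivative_test_max[OF d g g' m] by auto
qed

section \<open>Barrier functions\<close>

lemma DERIV_inner_line:
  fixes x a y :: "'a::real_inner"
  shows "((\<lambda>t. (x + t *\<^sub>R a - y) \<bullet> a) has_real_derivative a \<bullet> a) (at 0)"
    and "((\<lambda>t. (x + t *\<^sub>R a - y) \<bullet> (x + t *\<^sub>R a - y)) has_real_derivative 2 * ((x - y) \<bullet> a)) (at 0)"
proof -
  have "(\<lambda>t. (x + t *\<^sub>R a - y) \<bullet> a) = (\<lambda>t. (x - y) \<bullet> a + t * (a \<bullet> a))"
    by (simp add: fun_eq_iff algebra_simps)
  then show "((\<lambda>t. (x + t *\<^sub>R a - y) \<bullet> a) has_real_derivative a \<bullet> a) (at 0)"
    by (auto intro!: derivative_eq_intros)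
  have "(\<lambda>t. (x + t *\<^sub>R a - y) \<bullet> (x + t *\<^sub>R a - y))
      = (\<lambda>t. (x - y) \<bullet> (x - y) + t * (2 * ((x - y) \<bullet> a)) + t\<^sup>2 * (a \<bullet> a))"
    by (simp add: fun_eq_iff algebra_simps inner_commute power2_eq_square)
  then show "((\<lambda>t. (x + t *\<^sub>R a - y) \<bullet> (x + t *\<^sub>R a - y)) has_real_derivative 2 * ((x - y) \<bullet> a)) (at 0)"
    by (auto intro!: derivative_eq_intros)
qed

lemma directional_derivatives_norm_sq:
  "directional_derivatives (\<lambda>x. - e * (x \<bullet> x)) (\<lambda>x a. - e * (2 * (x \<bullet> a))) (\<lambda>x a. - e * (2 * (a \<bullet> a)))"
  unfolding directional_derivatives_def
proof (intro allI conjI)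
  fix x a :: 'a
  show "((\<lambda>t. - e * ((x + t *\<^sub>R a) \<bullet> (x + t *\<^sub>R a))) has_real_derivative - e * (2 * (x \<bullet> a))) (at 0)"
    using DERIV_cmult[OF DERIV_inner_line(2)[of x a 0], of "- e"] by simp
  show "((\<lambda>t. - e * (2 * ((x + t *\<^sub>R a) \<bullet> a))) has_real_derivative - e * (2 * (a \<bullet> a))) (at 0)"
    using DERIV_cmult[OF DERIV_cmult[OF DERIV_inner_line(1)[of x a 0]], of "- e" 2] by simp
qed

lemma directional_derivatives_gaussian:
  "directional_derivatives
     (\<lambda>x. d * (exp (- \<alpha> * ((x - y) \<bullet> (x - y))) - c))
     (\<lambda>x a. d * (- 2 * \<alpha> * ((x - y) \<bullet> a) * exp (- \<alpha> * ((x - y) \<bullet> (x - y)))))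
     (\<lambda>x a. d * ((4 * \<alpha>\<^sup>2 * ((x - y) \<bullet> a)\<^sup>2 - 2 * \<alpha> * (a \<bullet> a)) * exp (- \<alpha> * ((x - y) \<bullet> (x - y)))))"
  unfolding directional_derivatives_def
proof (intro allI conjI)
  fix x a
  define q where "q = (\<lambda>t. (x + t *\<^sub>R a - y) \<bullet> (x + t *\<^sub>R a - y))"
  define l where "l = (\<lambda>t. (x + t *\<^sub>R a - y) \<bullet> a)"
  have q: "(q has_real_derivative 2 * l 0) (at 0)" and l: "(l has_real_derivative a \<bullet> a) (at 0)"
    using DERIV_inner_line[of x a y] by (simp_all add: q_def l_def)
  have e: "((\<lambda>t. exp (- \<alpha> * q t)) has_real_derivative - 2 * \<alpha> * l 0 * exp (- \<alpha> * q 0)) (at 0)"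
    using DERIV_chain2[OF DERIV_exp DERIV_cmult[OF q, of "- \<alpha>"]] by (simp add: mult_ac)
  have "((\<lambda>t. d * (exp (- \<alpha> * q t) - c)) has_real_derivative d * (- 2 * \<alpha> * l 0 * exp (- \<alpha> * q 0) - 0)) (at 0)"
    by (intro DERIV_cmult DERIV_diff e DERIV_const)
  then show "((\<lambda>t. d * (exp (- \<alpha> * ((x + t *\<^sub>R a - y) \<bullet> (x + t *\<^sub>R a - y))) - c))
     has_real_derivative d * (- 2 * \<alpha> * ((x - y) \<bullet> a) * exp (- \<alpha> * ((x - y) \<bullet> (x - y))))) (at 0)"
    by (simp add: q_def l_def)
  have "((\<lambda>t. d * ((- 2 * \<alpha> * l t) * exp (- \<alpha> * q t))) has_real_derivative
      d * ((- 2 * \<alpha> * (a \<bullet> a)) * exp (- \<alpha> * q 0) + (- 2 * \<alpha> * l 0 * exp (- \<alpha> * q 0)) * (- 2 * \<alpha> * l 0))) (at 0)"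
    by (intro DERIV_cmult DERIV_mult e l)
  then have "((\<lambda>t. d * ((- 2 * \<alpha> * l t) * exp (- \<alpha> * q t))) has_real_derivative
      d * ((4 * \<alpha>\<^sup>2 * (l 0)\<^sup>2 - 2 * \<alpha> * (a \<bullet> a)) * exp (- \<alpha> * q 0))) (at 0)"
    by (rule DERIV_cong) (simp add: algebra_simps power2_eq_square)
  then show "((\<lambda>t. d * (- 2 * \<alpha> * ((x + t *\<^sub>R a - y) \<bullet> a) * exp (- \<alpha> * ((x + t *\<^sub>R a - y) \<bullet> (x + t *\<^sub>R a - y)))))
     has_real_derivative d * ((4 * \<alpha>\<^sup>2 * ((x - y) \<bullet> a)\<^sup>2 - 2 * \<alpha> * (a \<bullet> a)) * exp (- \<alpha> * ((x - y) \<bullet> (x - y))))) (at 0)"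
    by (simp only: q_def l_def scaleR_zero_left add_0_right)
qed

text \<open>At a local maximum of \<open>f + h\<close> the drift term vanishes and every summand of
  the second order part is at most 0, which contradicts \<open>h\<close> being a strict subsolution
  at \<open>p\<close>.\<close>

lemma drift_maximum_principle:
  assumes f: "directional_derivatives f f1 f2" and h: "directional_derivatives h h1 h2"
    and eq: "(\<Sum>k\<in>K. f2 p (c k)) = m * f1 p p"
    and sub: "m * h1 p p < (\<Sum>k\<in>K. h2 p (c k))"
    and r: "0 < r" and max: "\<And>y. y \<in> ball p r \<Longrightarrow> f y + h y \<le> f p + h p"
  shows False
proof -
  have fh: "directional_derivatives (\<lambda>x. f x + h x) (\<lambda>x a. f1 x a + h1 x a) (\<lambda>x a. f2 x a + h2 x a)"
    by (rule directional_derivatives_add[OF f h])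
  have 1: "f1 p p + h1 p p = 0" and 2: "f2 p a + h2 p a \<le> 0" for a
    using directional_derivatives_local_max[OF fh r max] by auto
  have "(\<Sum>k\<in>K. f2 p (c k)) + (\<Sum>k\<in>K. h2 p (c k)) \<le> 0"
    unfolding sum.distrib[symmetric] by (rule sum_nonpos) (rule 2)
  moreover have "m * f1 p p = - (m * h1 p p)"
    using 1 by (metis add_eq_0_iff2 mult_minus_right)
  ultimately show False using eq sub by linarith
qed

text \<open>The largest ball about \<open>y\<close> avoiding \<open>K\<close> may meet
  \<open>K\<close> in many boundary points. Halving it towards one nearest point \<open>q\<close>
  leaves \<open>q\<close> as the only contact; the parallelogram law gives the uniqueness.\<close>

lemma touching_ball:
  fixes K :: "'a::euclidean_space set"
  assumes "closed K" "K \<noteq> {}" "K \<noteq> UNIV"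
  obtains q y r where "q \<in> K" "0 < r" "dist q y = r" "\<And>z. z \<in> K \<Longrightarrow> dist z y \<le> r \<Longrightarrow> z = q"
proof -
  obtain y where y: "y \<notin> K" using assms(3) by blast
  obtain q where q: "q \<in> K" "\<And>z. z \<in> K \<Longrightarrow> dist y q \<le> dist y z"
    using distance_attains_inf[OF assms(1,2)] by blast
  define v where "v = (q - y) /\<^sub>R 2"
  have qv: "q = y + 2 *\<^sub>R v" by (simp add: v_def)
  have v0: "v \<noteq> 0" using y q(1) qv by auto
  show thesis
  proof (rule that[of q "norm v" "y + v"])
    show "q \<in> K" by fact
    show "0 < norm v" using v0 by simp
    show "dist q (y + v) = norm v" by (simp add: qv dist_norm scaleR_2)
    fix z assume z: "z \<in> K" "dist z (y + v) \<le> norm v"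
    define w where "w = z - y - v"
    have zw: "z = y + v + w" by (simp add: w_def)
    have w: "norm w \<le> norm v" using z(2) by (simp add: zw dist_norm)
    have "dist y z = norm (v + w)"
      unfolding dist_commute[of y z] by (simp add: zw dist_norm algebra_simps)
    then have "norm (2 *\<^sub>R v) \<le> norm (v + w)"
      using q(2)[OF z(1)] by (simp add: qv dist_norm)
    then have 1: "(norm (2 *\<^sub>R v))\<^sup>2 \<le> (norm (v + w))\<^sup>2" by (rule power_mono) simp
    have 2: "(norm w)\<^sup>2 \<le> (norm v)\<^sup>2" using w by (rule power_mono) simp
    have "(norm (v - w))\<^sup>2 \<le> 0"
      using 1 2 by (simp add: power2_norm_eq_inner inner_add inner_diff inner_commute)
    then have "w = v" by simp
    then show "z = q" by (simp add: zw qv scaleR_2)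
  qed
qed

text \<open>The second order part is the sum of second derivatives along the vectors
  \<open>c x k\<close>. The assumption \<open>upper\<close> bounds the trace of its coefficient
  matrix in terms of \<open>f\<close> itself, and \<open>lower\<close> is ellipticity with a
  constant that may degenerate at infinity. No regularity of \<open>c\<close> in \<open>x\<close>
  enters, since each comparison takes place at a single point.\<close>

locale drift_equation =
  fixes f :: "'a::euclidean_space \<Rightarrow> real" and f1 f2 :: "'a \<Rightarrow> 'a \<Rightarrow> real"
    and K :: "'k set" and c :: "'a \<Rightarrow> 'k \<Rightarrow> 'a" and N :: real and \<Lambda> :: "'a \<Rightarrow> real"
  assumes dd: "directional_derivatives f f1 f2"
    and cont: "continuous_on UNIV f"
    and nonpos: "f x \<le> 0"
    and eq: "(\<Sum>k\<in>K. f2 x (c x k)) = 2 * f1 x x"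
    and upper: "(\<Sum>k\<in>K. c x k \<bullet> c x k) \<le> N * (f x)\<^sup>2"
    and lower: "w \<bullet> w \<le> \<Lambda> x * (\<Sum>k\<in>K. (w \<bullet> c x k)\<^sup>2)"
    and cont_\<Lambda>: "continuous_on UNIV \<Lambda>"
begin

text \<open>The diffusion coefficients are controlled only by \<open>f\<close> itself, so \<open>\<bar>x\<bar>\<^sup>2\<close> is a barrier
  merely on superlevel sets of \<open>f\<close>; as \<open>f \<le> 0\<close>, this still forces the maximum to be attained.\<close>

lemma attains_max: obtains p where "\<And>y. f y \<le> f p"
proof -
  \<comment> \<open>Wherever \<open>f\<close> is at least \<open>f 0\<close>, it lies between
    \<open>- M\<close> and 0, so \<open>upper\<close> bounds the coefficient trace by
    \<open>N\<close> times the square of \<open>M\<close>. The radius \<open>R\<close> is chosen to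
    dominate this, so that the drift beats the diffusion outside the ball.\<close>
  define M where "M = 1 - f 0"
  have M: "0 < M" using nonpos[of 0] by (simp add: M_def)
  define R where "R = (\<bar>N\<bar> + 1) * M"
  have R: "0 < R" using M by (simp add: R_def add_nonneg_pos)
  have NR: "N * M\<^sup>2 \<le> R\<^sup>2"
  proof -
    have "\<bar>N\<bar> * 1 \<le> (\<bar>N\<bar> + 1) * (\<bar>N\<bar> + 1)" by (intro mult_mono) auto
    then have "N \<le> (\<bar>N\<bar> + 1)\<^sup>2" by (simp add: power2_eq_square)
    then show ?thesis unfolding R_def power_mult_distrib by (rule mult_right_mono) simp
  qed
  obtain p where p: "p \<in> cball 0 R" "\<And>y. y \<in> cball 0 R \<Longrightarrow> f y \<le> f p"
    using continuous_attains_sup[of "cball 0 R" f] continuous_on_subset[OF cont] R by auto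
  have "f y \<le> f p" for y
  proof (rule ccontr)
    assume "\<not> f y \<le> f p"
    then have y: "f p < f y" by simp
    then have yR: "R < norm y" using p(2)[of y] by force
    then have y0: "0 < y \<bullet> y" using R by auto
    \<comment> \<open>With this \<open>e\<close> the penalty at \<open>y\<close> uses up only half
      of the excess of \<open>f y\<close> over \<open>f p\<close>.\<close>
    define e where "e = (f y - f p) / (2 * (y \<bullet> y))"
    have e: "0 < e" using y y0 by (simp add: e_def)
    have ey: "f p < f y + - e * (y \<bullet> y)" using y y0 by (simp add: e_def field_simps)
    define h where "h = (\<lambda>x::'a. - e * (x \<bullet> x))"
    \<comment> \<open>On the sphere of radius \<open>R1\<close> the penalty is at least
      \<open>\<bar>f p\<bar>\<close>; as \<open>f\<close> is nonpositive, the penalised function is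
      at most \<open>f p\<close> there and its maximum over the ball is interior.\<close>
    define R1 where "R1 = norm y + 1 + \<bar>f p\<bar> / e"
    have R1: "norm y \<le> R1" "1 \<le> R1" "\<bar>f p\<bar> / e \<le> R1" using e by (auto simp: R1_def)
    have contfh: "continuous_on (cball 0 R1) (\<lambda>x. f x + h x)"
      unfolding h_def by (intro continuous_intros continuous_on_subset[OF cont]) auto
    obtain q where q: "q \<in> cball 0 R1" "\<And>x. x \<in> cball 0 R1 \<Longrightarrow> f x + h x \<le> f q + h q"
      using continuous_attains_sup[OF _ _ contfh] R1 by auto
    have fq: "f p < f q + h q" using q(2)[of y] R1(1) ey by (simp add: h_def)
    have "h q \<le> 0" using e by (simp add: h_def)
    then have fpq: "f p < f q" using fq by simp
    have "f 0 \<le> f p" using p(2)[of 0] R by simp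
    then have "- M < f q" using fpq by (simp add: M_def)
    then have "\<bar>f q\<bar> \<le> \<bar>M\<bar>" using nonpos[of q] by simp
    then have fM: "(f q)\<^sup>2 \<le> M\<^sup>2" by (simp add: abs_le_square_iff)
    have qR: "R < norm q" using p(2)[of q] fpq by force
    have qR1: "norm q < R1"
    proof (rule ccontr)
      assume "\<not> norm q < R1"
      then have n: "norm q = R1" using q(1) by simp
      have "\<bar>f p\<bar> = e * (\<bar>f p\<bar> / e)" using e by simp
      also have "\<dots> \<le> e * R1" using R1 e by (intro mult_left_mono) auto
      also have "\<dots> \<le> e * (R1 * R1)" using R1 e by (intro mult_left_mono) auto
      also have "\<dots> = - h q" using n by (simp add: h_def power2_norm_eq_inner[symmetric] power2_eq_square)
      finally show False using fq nonpos[of q] by linarith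
    qed
    have sub: "2 * (- e * (2 * (q \<bullet> q))) < (\<Sum>k\<in>K. - e * (2 * (c q k \<bullet> c q k)))"
    proof -
      have "(\<Sum>k\<in>K. c q k \<bullet> c q k) \<le> R\<^sup>2"
      proof (cases "0 \<le> N")
        case True
        then have "N * (f q)\<^sup>2 \<le> N * M\<^sup>2" using fM by (rule mult_left_mono[rotated])
        then show ?thesis using upper[of q] NR by linarith
      next
        case False
        then have "N * (f q)\<^sup>2 \<le> 0" by (simp add: mult_nonpos_nonneg)
        then show ?thesis using upper[of q] by (smt (verit) zero_le_power2)
      qed
      also have "\<dots> < (norm q)\<^sup>2" using qR R by (intro power_strict_mono) auto
      also have "\<dots> \<le> 2 * (q \<bullet> q)" by (simp add: power2_norm_eq_inner)
      finally have "(\<Sum>k\<in>K. c q k \<bullet> c q k) < 2 * (q \<bullet> q)" .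
      then show ?thesis using e by (simp add: sum_distrib_left[symmetric] sum_negf)
    qed
    show False
    proof (rule drift_maximum_principle[OF dd directional_derivatives_norm_sq eq sub])
      show "0 < R1 - norm q" using qR1 by simp
      fix x assume "x \<in> ball q (R1 - norm q)"
      then have "norm x \<le> R1" using norm_triangle_ineq2[of x q] by (simp add: dist_norm norm_minus_commute)
      then show "f x + - e * (x \<bullet> x) \<le> f q + - e * (q \<bullet> q)" using q(2)[of x] by (simp add: h_def)
    qed
  qed
  then show thesis using that by blast
qed

text \<open>This is the Hopf barrier. Away from \<open>y\<close> the term quadratic in
  \<open>\<alpha>\<close> is bounded below by ellipticity, while the diffusion and drift terms grow
  only linearly in \<open>\<alpha>\<close>.\<close>

lemma gaussian_subsolution:
  assumes B: "compact B" and r: "0 < r" and away: "\<And>x. x \<in> B \<Longrightarrow> r \<le> dist x y"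
  obtains \<alpha> where "0 < \<alpha>"
    "\<And>x d. x \<in> B \<Longrightarrow> 0 < d \<Longrightarrow>
       2 * (d * (- 2 * \<alpha> * ((x - y) \<bullet> x) * exp (- \<alpha> * ((x - y) \<bullet> (x - y)))))
       < (\<Sum>k\<in>K. d * ((4 * \<alpha>\<^sup>2 * ((x - y) \<bullet> c x k)\<^sup>2 - 2 * \<alpha> * (c x k \<bullet> c x k))
            * exp (- \<alpha> * ((x - y) \<bullet> (x - y)))))"
proof -
  have bound: "\<exists>b>0. \<forall>x\<in>B. g x \<le> b" if "continuous_on UNIV g" for g :: "'a \<Rightarrow> real"
  proof -
    have "bounded (g ` B)"
      by (intro compact_imp_bounded compact_continuous_image continuous_on_subset[OF that] B) simp
    then obtain b where "0 < b" "\<forall>z\<in>g ` B. norm z \<le> b" unfolding bounded_pos by blast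
    then show ?thesis by (intro exI[of _ b]) force
  qed
  obtain L where L: "0 < L" "\<And>x. x \<in> B \<Longrightarrow> \<Lambda> x \<le> L" using bound[OF cont_\<Lambda>] by blast
  obtain b1 where b1: "0 < b1" "\<And>x. x \<in> B \<Longrightarrow> N * (f x)\<^sup>2 \<le> b1"
    using bound[of "\<lambda>x. N * (f x)\<^sup>2"] continuous_on_mult_left[OF continuous_on_power[OF cont]] by blast
  obtain b2 where b2: "0 < b2" "\<And>x. x \<in> B \<Longrightarrow> - ((x - y) \<bullet> x) \<le> b2"
  proof -
    have "continuous_on UNIV (\<lambda>x. - ((x - y) \<bullet> x))" by (intro continuous_intros)
    then show ?thesis using bound that by blast
  qed
  define \<kappa> where "\<kappa> = r\<^sup>2 / L"
  have \<kappa>: "0 < \<kappa>" using r L by (simp add: \<kappa>_def)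
  \<comment> \<open>After division by the positive factor \<open>d * E * \<alpha>\<close>, the claim
    is \<open>4 * (\<alpha> * S) - 2 * T + 4 * P > 0\<close>; here \<open>T\<close> is at most
    \<open>b1\<close>, \<open>P\<close> at least \<open>- b2\<close>, and \<open>S\<close> at least
    \<open>\<kappa>\<close>.\<close>
  define \<alpha> where "\<alpha> = (b1 + 2 * b2) / \<kappa>"
  have \<alpha>: "0 < \<alpha>" using \<kappa> b1 b2 by (simp add: \<alpha>_def)
  show thesis
  proof (rule that[OF \<alpha>])
    fix x :: 'a and d :: real assume x: "x \<in> B" and d: "0 < d"
    define E where "E = exp (- \<alpha> * ((x - y) \<bullet> (x - y)))"
    define S where "S = (\<Sum>k\<in>K. ((x - y) \<bullet> c x k)\<^sup>2)"
    define T where "T = (\<Sum>k\<in>K. c x k \<bullet> c x k)"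
    have "r\<^sup>2 \<le> (norm (x - y))\<^sup>2" using away[OF x] r by (intro power_mono) (auto simp: dist_norm)
    also have "\<dots> \<le> \<Lambda> x * S" using lower[of "x - y" x] by (simp add: S_def power2_norm_eq_inner)
    also have "\<dots> \<le> L * S" using L(2)[OF x] by (intro mult_right_mono) (auto simp: S_def sum_nonneg)
    finally have S: "\<kappa> \<le> S" using L(1) by (simp add: \<kappa>_def field_simps)
    have T: "T \<le> b1" using upper[of x] b1(2)[OF x] by (simp add: T_def)
    have "b1 + 2 * b2 = \<alpha> * \<kappa>" using \<kappa> by (simp add: \<alpha>_def)
    also have "\<dots> \<le> \<alpha> * S" using S \<alpha> by simp
    finally have aS: "b1 + 2 * b2 \<le> \<alpha> * S" .
    define P where "P = (x - y) \<bullet> x"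
    have "0 < 4 * (\<alpha> * S) - 2 * T + 4 * P"
      using aS T b2(2)[OF x] b1(1) b2(1) unfolding P_def by linarith
    then have "0 < d * E * \<alpha> * (4 * (\<alpha> * S) - 2 * T + 4 * P)"
      using d \<alpha> by (simp add: E_def)
    then have "2 * (d * (- 2 * \<alpha> * P * E)) < d * ((4 * \<alpha>\<^sup>2 * S - 2 * \<alpha> * T) * E)"
      by (simp add: algebra_simps power2_eq_square)
    also have "\<dots> = (\<Sum>k\<in>K. d * ((4 * \<alpha>\<^sup>2 * ((x - y) \<bullet> c x k)\<^sup>2 - 2 * \<alpha> * (c x k \<bullet> c x k)) * E))"
      by (simp add: S_def T_def sum_distrib_left[symmetric] sum_distrib_right[symmetric] sum_subtractf)
    finally show "2 * (d * (- 2 * \<alpha> * ((x - y) \<bullet> x) * exp (- \<alpha> * ((x - y) \<bullet> (x - y)))))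
       < (\<Sum>k\<in>K. d * ((4 * \<alpha>\<^sup>2 * ((x - y) \<bullet> c x k)\<^sup>2 - 2 * \<alpha> * (c x k \<bullet> c x k))
            * exp (- \<alpha> * ((x - y) \<bullet> (x - y)))))"
      unfolding E_def P_def .
  qed
qed

lemma strong_maximum_principle:
  assumes max: "\<And>y. f y \<le> f p"
  shows "f y = f p"
proof -
  define Z where "Z = {x. f x = f p}"
  have "Z = UNIV"
  proof (rule ccontr)
    assume "Z \<noteq> UNIV"
    moreover have "closed Z"
      using continuous_closed_preimage_constant[OF cont closed_UNIV] by (simp add: Z_def)
    moreover have "Z \<noteq> {}" by (auto simp: Z_def)
    ultimately obtain q y r where q: "q \<in> Z" and r: "0 < r" and qy: "dist q y = r"
      and touch: "\<And>z. z \<in> Z \<Longrightarrow> dist z y \<le> r \<Longrightarrow> z = q"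
      using touching_ball[of Z] by metis
    \<comment> \<open>Half the radius keeps \<open>B\<close> away from the centre \<open>y\<close>,
      where the Gaussian has no gradient and fails to be a subsolution.\<close>
    define B where "B = cball q (r / 2)"
    have away: "r / 2 \<le> dist x y" if "x \<in> B" for x
      using that qy dist_triangle[of q y x] by (simp add: B_def)
    have "compact B" "0 < r / 2" using r by (auto simp: B_def)
    then obtain \<alpha> where \<alpha>: "0 < \<alpha>" and
      sub: "\<And>x d. x \<in> B \<Longrightarrow> 0 < d \<Longrightarrow>
       2 * (d * (- 2 * \<alpha> * ((x - y) \<bullet> x) * exp (- \<alpha> * ((x - y) \<bullet> (x - y)))))
       < (\<Sum>k\<in>K. d * ((4 * \<alpha>\<^sup>2 * ((x - y) \<bullet> c x k)\<^sup>2 - 2 * \<alpha> * (c x k \<bullet> c x k))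
            * exp (- \<alpha> * ((x - y) \<bullet> (x - y)))))"
      using gaussian_subsolution[of B "r / 2" y] away by blast
    \<comment> \<open>The boundary of \<open>B\<close> splits in two. On \<open>S\<close>, which
      misses the contact set, compactness keeps \<open>f\<close> below its maximum by a fixed
      \<open>\<eta>\<close>, more than the bump \<open>h\<close> can add; off the touching ball
      \<open>h\<close> is negative. Since \<open>f + h\<close> equals \<open>f p\<close> at
      \<open>q\<close>, its maximum over \<open>B\<close> is interior.\<close>
    define S where "S = sphere q (r / 2) \<inter> cball y r"
    have S: "f x < f p" if "x \<in> S" for x
    proof -
      have "x \<notin> Z" using touch[of x] that r by (auto simp: S_def dist_commute)
      then show ?thesis using max[of x] by (auto simp: Z_def)
    qed
    obtain \<eta> where \<eta>: "0 < \<eta>" "\<And>x. x \<in> S \<Longrightarrow> f x \<le> f p - \<eta>"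
    proof (cases "S = {}")
      case True
      then show ?thesis using that[of 1] by auto
    next
      case False
      have "compact S" by (auto simp: S_def intro: compact_Int)
      then obtain s where "s \<in> S" "\<And>x. x \<in> S \<Longrightarrow> f x \<le> f s"
        using continuous_attains_sup[OF _ False continuous_on_subset[OF cont]] by blast
      then show ?thesis using that[of "f p - f s"] S[of s] by auto
    qed
    define d where "d = \<eta> / 2"
    have d: "0 < d" "d < \<eta>" using \<eta> by (auto simp: d_def)
    define h where "h = (\<lambda>x::'a. d * (exp (- \<alpha> * ((x - y) \<bullet> (x - y))) - exp (- \<alpha> * r\<^sup>2)))"
    have hd: "h x \<le> d" for x
    proof -
      have "exp (- \<alpha> * ((x - y) \<bullet> (x - y))) \<le> 1" using \<alpha> by simp
      then have "exp (- \<alpha> * ((x - y) \<bullet> (x - y))) - exp (- \<alpha> * r\<^sup>2) \<le> 1"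
        using exp_ge_zero[of "- \<alpha> * r\<^sup>2"] by linarith
      then have "h x \<le> d * 1" unfolding h_def using d(1) by (intro mult_left_mono) auto
      then show ?thesis by simp
    qed
    have hneg: "h x < 0" if "r < dist x y" for x
    proof -
      have "r\<^sup>2 < (dist x y)\<^sup>2" using that r by (intro power_strict_mono) auto
      then have "r\<^sup>2 < (x - y) \<bullet> (x - y)" by (simp add: dist_norm power2_norm_eq_inner)
      then have "- \<alpha> * ((x - y) \<bullet> (x - y)) < - \<alpha> * r\<^sup>2" using \<alpha> by simp
      then have "exp (- \<alpha> * ((x - y) \<bullet> (x - y))) < exp (- \<alpha> * r\<^sup>2)" by (simp only: exp_less_cancel_iff)
      then show ?thesis using d by (simp add: h_def mult_pos_neg)
    qed
    have hq: "h q = 0"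
      using qy by (simp add: h_def power2_norm_eq_inner[symmetric] dist_norm)
    have contfh: "continuous_on B (\<lambda>x. f x + h x)"
      unfolding h_def by (intro continuous_intros continuous_on_subset[OF cont]) auto
    have "B \<noteq> {}" using r by (auto simp: B_def)
    then obtain w where w: "w \<in> B" "\<And>x. x \<in> B \<Longrightarrow> f x + h x \<le> f w + h w"
      using continuous_attains_sup[OF \<open>compact B\<close> _ contfh] by blast
    have fw: "f p \<le> f w + h w" using w(2)[of q] hq q r by (simp add: B_def Z_def)
    have inside: "dist q w < r / 2"
    proof (rule ccontr)
      assume "\<not> dist q w < r / 2"
      then have ws: "w \<in> sphere q (r / 2)" using w(1) by (simp add: B_def)
      show False
      proof (cases "dist w y \<le> r")
        case True
        then have "w \<in> S" using ws by (simp add: S_def dist_commute)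
        then show False using \<eta>(2)[of w] hd[of w] d fw by linarith
      next
        case False
        then show False using hneg[of w] fw max[of w] by linarith
      qed
    qed
    show False
    proof (rule drift_maximum_principle[OF dd directional_derivatives_gaussian eq sub[OF w(1) d(1)]])
      show "0 < r / 2 - dist q w" using inside by simp
      fix x assume "x \<in> ball w (r / 2 - dist q w)"
      then have "x \<in> B" using dist_triangle[of q x w] by (simp add: B_def)
      then show "f x + d * (exp (- \<alpha> * ((x - y) \<bullet> (x - y))) - exp (- \<alpha> * r\<^sup>2))
          \<le> f w + d * (exp (- \<alpha> * ((w - y) \<bullet> (w - y))) - exp (- \<alpha> * r\<^sup>2))"
        using w(2)[of x] by (simp add: h_def)
    qed
  qed
  then show ?thesis by (auto simp: Z_def)
qed

theorem liouville: "\<exists>m. \<forall>x. f x = m"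
  using attains_max strong_maximum_principle by metis

end

subsection \<open>Eigenvalues and the trace of the inverse\<close>

text \<open>A moved point and its image are distinct and both moved, so one of them differs from
  \<open>i\<close>.\<close>

lemma not_id_two_moved:
  assumes "p permutes UNIV" "p \<noteq> id"
  obtains j where "j \<noteq> i" "p j \<noteq> j"
proof -
  obtain k where k: "p k \<noteq> k" using assms(2) by (auto simp: fun_eq_iff)
  then have "p (p k) \<noteq> p k" using permutes_inj[OF assms(1)] by (metis injD)
  then show thesis using that[of k] that[of "p k"] k by metis
qed

lemma mat_mult_entry:
  fixes A :: "complex^'n^'n"
  shows "(mat x ** A) $ i $ j = x * A $ i $ j" "(A ** mat x) $ i $ j = x * A $ i $ j"
  by (simp_all add: mat_def matrix_matrix_mult_def if_distrib[of "\<lambda>a. a * _"]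
      if_distrib[of "\<lambda>a. _ * a"] sum.delta sum.delta' cong: if_cong)

text \<open>In the Leibniz formula the product rule removes one factor at a time. A permutation
  other than the identity still has an off-diagonal factor left, and that factor vanishes at 0; only
  the diagonal product contributes.\<close>

lemma DERIV_det_near_id:
  fixes A :: "complex^'n^'n"
  shows "((\<lambda>x. det (mat 1 - mat x ** A)) has_field_derivative - trace A) (at 0)"
proof -
  define g where "g = (\<lambda>i j x. (if i = j then 1 else 0) - x * A $ i $ j)"
  have entry: "(mat 1 - mat x ** A) $ i $ j = g i j x" for x i j
    by (simp add: g_def mat_mult_entry) (simp add: mat_def)
  define P where "P = {p. p permutes (UNIV :: 'n set)}"
  have g: "(g i j has_field_derivative - A $ i $ j) (at 0)" for i j
    unfolding g_def by (auto intro!: derivative_eq_intros)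
  define d where "d = (\<lambda>p. \<Sum>i\<in>UNIV. - A $ i $ p i * (\<Prod>k\<in>UNIV - {i}. g k (p k) 0))"
  have "((\<lambda>x. \<Sum>p\<in>P. of_int (sign p) * (\<Prod>i\<in>UNIV. g i (p i) x)) has_field_derivative
      (\<Sum>p\<in>P. of_int (sign p) * d p)) (at 0)"
    unfolding d_def by (intro DERIV_sum DERIV_cmult has_field_derivative_prod g)
  moreover have "(\<Sum>p\<in>P. of_int (sign p) * d p) = of_int (sign (id :: 'n \<Rightarrow> 'n)) * d id"
  proof -
    have "d p = 0" if p: "p \<in> P" "p \<noteq> id" for p
    proof -
      have "(\<Prod>k\<in>UNIV - {i}. g k (p k) 0) = 0" for i
      proof -
        obtain j where "j \<noteq> i" "p j \<noteq> j" 
          using not_id_two_moved p by (metis P_def mem_Collect_eq)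
        then show ?thesis by (intro prod_zero bexI[of _ j]) (auto simp: g_def)
      qed
      then show ?thesis unfolding d_def by (simp only: mult_zero_right sum.neutral_const)
    qed
    then have "(\<Sum>p\<in>P. of_int (sign p) * d p) = (\<Sum>p\<in>{id}. of_int (sign p) * d p)"
      by (intro sum.mono_neutral_right) (auto simp: P_def permutes_id finite_permutations)
    then show ?thesis by simp
  qed
  moreover have "d id = - trace A" by (simp add: d_def g_def trace_def sum_negf)
  moreover have "det (mat 1 - mat x ** A) = (\<Sum>p\<in>P. of_int (sign p) * (\<Prod>i\<in>UNIV. g i (p i) x))" for x
    unfolding det_def entry P_def ..
  ultimately show ?thesis by (simp add: sign_id)
qed

lemma poly_charpoly: "poly (charpoly A) x = det (mat x - A)"
proof -
  have "poly ((mat [:0, 1:] - (\<chi> i j. [:A $ i $ j:])) $ i $ j) x = (mat x - A) $ i $ j" for i j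
    by (simp add: mat_def)
  then show ?thesis
    by (simp only: charpoly_def det_def poly_sum poly_mult poly_of_int poly_prod)
qed

text \<open>Otherwise \<open>det (mat 1 - mat y ** A)\<close>, a multiple of the characteristic
  polynomial at \<open>1 / y\<close>, would vanish for all nonzero \<open>y\<close>, although it
  tends to 1 as \<open>y\<close> tends to 0.\<close>

lemma charpoly_nonzero: "charpoly (A :: complex^'n^'n) \<noteq> 0"
proof
  assume "charpoly A = 0"
  then have z: "det (mat x - A) = 0" for x using poly_charpoly[of A x] by simp
  have "det (mat 1 - mat y ** A) = 0" if "y \<noteq> 0" for y
  proof -
    have "mat 1 - mat y ** A = mat y ** (mat (1 / y) - A)"
      using that by (simp add: vec_eq_iff mat_mult_entry) (simp add: mat_def right_diff_distrib)
    then show ?thesis using z by (simp add: det_mul)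
  qed
  then have "eventually (\<lambda>y. det (mat 1 - mat y ** A) = 0) (at 0)"
    by (auto simp: eventually_at_filter)
  then have "((\<lambda>y. det (mat 1 - mat y ** A)) \<longlongrightarrow> 0) (at 0)"
    by (rule tendsto_eventually)
  moreover have "((\<lambda>y. det (mat 1 - mat y ** A)) \<longlongrightarrow> 1) (at 0)"
    using DERIV_isCont[OF DERIV_det_near_id[of A]] by (simp add: isCont_def)
  ultimately show False using tendsto_unique[of "at (0::complex)"] by fastforce
qed

lemma log_deriv_at_zero:
  fixes M :: "complex multiset"
  assumes "\<forall>\<mu>\<in>#M. \<mu> \<noteq> 0"
  shows "poly (pderiv (\<Prod>\<mu>\<in>#M. [:- \<mu>, 1:])) 0 = - (\<Sum>\<mu>\<in>#M. 1 / \<mu>) * poly (\<Prod>\<mu>\<in>#M. [:- \<mu>, 1:]) 0"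
  using assms
proof (induction M)
  case empty
  then show ?case by simp
next
  case (add x M)
  define P where "P = (\<Prod>\<mu>\<in>#M. [:- \<mu>, 1:])"
  define S where "S = (\<Sum>\<mu>\<in>#M. 1 / \<mu>)"
  have "poly (pderiv ([:- x, 1:] * P)) 0 = - x * poly (pderiv P) 0 + poly P 0"
    unfolding pderiv_mult by (simp add: pderiv_pCons)
  also have "\<dots> = - (1 / x + S) * poly ([:- x, 1:] * P) 0"
    using add by (simp add: P_def[symmetric] S_def[symmetric] field_simps)
  finally show ?case by (simp add: P_def S_def)
qed

text \<open>The derivative of the characteristic polynomial at 0 is computed twice: from
  \<open>det (- A) * det (mat 1 - mat x ** C)\<close> and, as a logarithmic derivative, from the
  factorisation into roots. Multiplicities are accounted for without triangularising
  \<open>A\<close>.\<close>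

lemma sum_inverse_eigenvalues:
  fixes A :: "complex^'n^'n"
  assumes nz: "\<forall>\<mu>\<in>#eigenvalues A. \<mu> \<noteq> 0"
  obtains C where "A ** C = mat 1" "(\<Sum>\<mu>\<in>#eigenvalues A. 1 / \<mu>) = trace C"
proof -
  have "0 \<notin># eigenvalues A" using nz by blast
  then have p0: "poly (charpoly A) 0 \<noteq> 0" by (simp add: eigenvalues_def charpoly_nonzero)
  then have d0: "det (- A) \<noteq> 0" by (simp add: poly_charpoly)
  then have "invertible (- A)" by (simp add: invertible_det_nz)
  then obtain D where D: "- A ** D = mat 1" by (auto simp: invertible_right_inverse)
  define C where "C = - D"
  have AC: "A ** C = mat 1"
    using D by (simp add: C_def vec_eq_iff matrix_matrix_mult_def)
  have "mat x - A = - A ** (mat 1 - mat x ** C)" for x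
  proof -
    have comm: "A ** mat x = mat x ** A"
      by (simp add: vec_eq_iff mat_mult_entry)
    have "A ** (mat x ** C) = mat x"
      by (simp add: matrix_mul_assoc comm) (simp add: matrix_mul_assoc[symmetric] AC)
    moreover have "- A ** (mat 1 - mat x ** C) = A ** (mat x ** C) - A ** mat 1"
      by (simp add: vec_eq_iff matrix_matrix_mult_def sum_subtractf[symmetric] algebra_simps
          del: matrix_mul_rid)
    ultimately show ?thesis by simp
  qed
  then have "poly (charpoly A) = (\<lambda>x. det (- A) * det (mat 1 - mat x ** C))"
    by (simp add: poly_charpoly det_mul fun_eq_iff)
  then have "(poly (charpoly A) has_field_derivative det (- A) * - trace C) (at 0)"
    using DERIV_cmult[OF DERIV_det_near_id[of C]] by simp
  then have "poly (pderiv (charpoly A)) 0 = det (- A) * - trace C"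
    by (rule DERIV_unique[OF poly_DERIV])
  moreover have "poly (pderiv (charpoly A)) 0 = - (\<Sum>\<mu>\<in>#eigenvalues A. 1 / \<mu>) * det (- A)"
  proof -
    define L where "L = (\<Prod>\<mu>\<in>#eigenvalues A. [:- \<mu>, 1:])"
    have L: "charpoly A = smult (lead_coeff (charpoly A)) L"
      unfolding L_def eigenvalues_def by (rule complex_poly_decompose_multiset[symmetric])
    have "poly (pderiv (charpoly A)) 0 = lead_coeff (charpoly A) * poly (pderiv L) 0"
      by (subst L) (simp add: pderiv_smult)
    also have "\<dots> = - (\<Sum>\<mu>\<in>#eigenvalues A. 1 / \<mu>) * (lead_coeff (charpoly A) * poly L 0)"
      using log_deriv_at_zero[OF nz] by (simp add: L_def)
    also have "lead_coeff (charpoly A) * poly L 0 = poly (charpoly A) 0"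
      by (subst (3) L) simp
    finally show ?thesis by (simp add: poly_charpoly)
  qed
  ultimately have "(\<Sum>\<mu>\<in>#eigenvalues A. 1 / \<mu>) = trace C" using d0 by simp
  then show thesis using that AC by blast
qed

subsection \<open>Hermitian matrices\<close>

definition hermitian :: "complex^'n^'n \<Rightarrow> bool" where
  "hermitian A \<longleftrightarrow> (\<forall>i j. A $ j $ i = cnj (A $ i $ j))"

definition hform :: "complex^'n^'n \<Rightarrow> complex^'n \<Rightarrow> real" where
  "hform A v = Re (\<Sum>i\<in>UNIV. \<Sum>j\<in>UNIV. A $ i $ j * v $ i * cnj (v $ j))"

lemma positive_semidefinite_iff:
  "positive_semidefinite A \<longleftrightarrow> hermitian A \<and> (\<forall>v. 0 \<le> hform A v)"
  unfolding positive_semidefinite_def hermitian_def hform_def by (rule refl)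

lemma hermitian_cnj: "hermitian A \<Longrightarrow> cnj (A $ i $ j) = A $ j $ i"
  unfolding hermitian_def by metis

text \<open>The adjoint of \<open>C\<close> is a left inverse of \<open>A\<close>, and a left
  inverse agrees with a right inverse.\<close>

lemma hermitian_inverse:
  assumes "hermitian A" "A ** C = mat 1"
  shows "hermitian C"
proof -
  define D where "D = (\<chi> i j. cnj (C $ j $ i))"
  have "D ** A = mat 1"
  proof -
    have "(D ** A) $ i $ j = cnj ((A ** C) $ j $ i)" for i j
      by (simp add: D_def matrix_matrix_mult_def hermitian_cnj[OF assms(1)] mult.commute)
    then show ?thesis unfolding assms(2) by (simp add: vec_eq_iff mat_def)
  qed
  have "D = D ** (A ** C)" by (simp add: assms(2))
  also have "\<dots> = C" by (simp add: matrix_mul_assoc \<open>D ** A = mat 1\<close>)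
  finally show ?thesis unfolding hermitian_def by (metis D_def vec_lambda_beta)
qed

lemma matrix_diff_mult:
  fixes A B C :: "complex^'n^'n"
  shows "A ** (B - C) = A ** B - A ** C" "(A - B) ** C = A ** C - B ** C"
  by (simp_all add: vec_eq_iff matrix_matrix_mult_def sum_subtractf algebra_simps)

text \<open>Because \<open>C\<close> is Hermitian, its conjugated rows are its columns. This writes
  the linear functional \<open>A \<mapsto> trace (C ** A ** C)\<close> as a sum of values of the
  form of \<open>A\<close>, hence later as a sum of directional second derivatives.\<close>

lemma hform_rows:
  assumes C: "hermitian C"
  shows "(\<Sum>k\<in>UNIV. hform A (C $ k)) = Re (trace (C ** A ** C))"
proof -
  have "(\<Sum>i\<in>UNIV. \<Sum>j\<in>UNIV. A $ i $ j * C $ k $ i * cnj (C $ k $ j)) = (C ** A ** C) $ k $ k" for k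
  proof -
    have "(C ** A ** C) $ k $ k = (\<Sum>j\<in>UNIV. \<Sum>i\<in>UNIV. A $ i $ j * C $ k $ i * cnj (C $ k $ j))"
      by (simp only: matrix_matrix_mult_def vec_lambda_beta sum_distrib_right hermitian_cnj[OF C])
        (simp only: mult_ac)
    also have "\<dots> = (\<Sum>i\<in>UNIV. \<Sum>j\<in>UNIV. A $ i $ j * C $ k $ i * cnj (C $ k $ j))"
      by (rule sum.swap)
    finally show ?thesis by (rule sym)
  qed
  then show ?thesis by (simp only: hform_def trace_def Re_sum)
qed

text \<open>The linearisation of the concave function \<open>A \<mapsto> - trace A\<^sup>-\<^sup>1\<close> at \<open>C\<^sup>-\<^sup>1\<close> lies above it,
  because \<open>(A\<^sup>-\<^sup>1 - C) A (A\<^sup>-\<^sup>1 - C)\<close> is positive semidefinite.\<close>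

lemma trace_inverse_tangent:
  assumes A: "positive_semidefinite A" and B: "A ** B = mat 1" and C: "hermitian C"
  shows "2 * Re (trace C) - (\<Sum>k\<in>UNIV. hform A (C $ k)) \<le> Re (trace B)"
proof -
  have BA: "B ** A = mat 1" using B matrix_left_right_inverse by blast
  have "hermitian B" using hermitian_inverse A B by (auto simp: positive_semidefinite_iff)
  then have E: "hermitian (B - C)"
    unfolding hermitian_def[of "B - C"] by (simp add: hermitian_cnj C)
  have "(B - C) ** A ** (B - C) = B - C - C + C ** A ** C"
    by (simp add: matrix_diff_mult B BA matrix_mul_assoc[symmetric])
  then have "Re (trace ((B - C) ** A ** (B - C))) = Re (trace B) - 2 * Re (trace C) + Re (trace (C ** A ** C))"
    by (simp only: trace_sub trace_add plus_complex.sel minus_complex.sel)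
  moreover have "0 \<le> Re (trace ((B - C) ** A ** (B - C)))"
    unfolding hform_rows[OF E, symmetric] using A by (simp add: positive_semidefinite_iff sum_nonneg)
  ultimately show ?thesis by (simp add: hform_rows[OF C])
qed

lemma trace_inverse_tangent_eq:
  assumes B: "A ** B = mat 1" and H: "hermitian B"
  shows "(\<Sum>k\<in>UNIV. hform A (B $ k)) = Re (trace B)"
proof -
  have "B ** A = mat 1" using B matrix_left_right_inverse by blast
  then show ?thesis by (simp add: hform_rows[OF H])
qed

lemma hform_alt: "hform A v = Re (\<Sum>j\<in>UNIV. (v v* A) $ j * cnj (v $ j))"
proof -
  have "(\<Sum>i\<in>UNIV. \<Sum>j\<in>UNIV. A $ i $ j * v $ i * cnj (v $ j))
      = (\<Sum>j\<in>UNIV. \<Sum>i\<in>UNIV. A $ i $ j * v $ i * cnj (v $ j))"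
    by (rule sum.swap)
  also have "\<dots> = (\<Sum>j\<in>UNIV. (v v* A) $ j * cnj (v $ j))"
    by (simp only: vector_matrix_mult_def vec_lambda_beta sum_distrib_right) (simp only: mult_ac)
  finally show ?thesis by (simp only: hform_def)
qed

lemma hform_vector_matrix:
  assumes "hermitian C"
  shows "hform A (v v* C) = hform (C ** A ** C) v"
proof -
  have C: "cnj (C $ i $ j) = C $ j $ i" for i j using assms by (rule hermitian_cnj)
  have c: "cnj ((v v* C) $ j) = (\<Sum>l\<in>UNIV. C $ j $ l * cnj (v $ l))" for j
    by (simp add: vector_matrix_mult_def C mult.commute)
  have x: "(x v* C) $ l * y = (\<Sum>j\<in>UNIV. x $ j * (C $ j $ l * y))" for x y l
    by (simp only: vector_matrix_mult_def vec_lambda_beta sum_distrib_right) (simp only: mult_ac)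
  have "(\<Sum>j\<in>UNIV. (v v* C v* A) $ j * cnj ((v v* C) $ j))
      = (\<Sum>j\<in>UNIV. \<Sum>l\<in>UNIV. (v v* C v* A) $ j * (C $ j $ l * cnj (v $ l)))"
    by (simp only: c sum_distrib_left)
  also have "\<dots> = (\<Sum>l\<in>UNIV. \<Sum>j\<in>UNIV. (v v* C v* A) $ j * (C $ j $ l * cnj (v $ l)))"
    by (rule sum.swap)
  also have "\<dots> = (\<Sum>l\<in>UNIV. (v v* C v* A v* C) $ l * cnj (v $ l))"
    by (simp only: x)
  finally show ?thesis unfolding hform_alt by (simp only: vector_matrix_mul_assoc matrix_mul_assoc)
qed

text \<open>Since \<open>B = B ** A ** B\<close>, the form of \<open>B\<close> at \<open>v\<close>
  is the form of \<open>A\<close> at \<open>v v* B\<close>.\<close>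

lemma positive_semidefinite_inverse:
  assumes A: "positive_semidefinite A" and B: "A ** B = mat 1"
  shows "positive_semidefinite B"
proof -
  have H: "hermitian B" using hermitian_inverse A B by (auto simp: positive_semidefinite_iff)
  have "B ** A = mat 1" using B matrix_left_right_inverse by blast
  then have "hform B v = hform A (v v* B)" for v by (simp add: hform_vector_matrix[OF H])
  then show ?thesis using A H by (simp add: positive_semidefinite_iff)
qed

text \<open>The case \<open>i = j\<close> is included, so diagonal entries can be read off with
  \<open>b = 0\<close>.\<close>

lemma hform_axis_add:
  assumes C: "hermitian C"
  shows "hform C (axis i a + axis j b) = (cmod a)\<^sup>2 * Re (C $ i $ i) + (cmod b)\<^sup>2 * Re (C $ j $ j)
    + 2 * Re (C $ i $ j * a * cnj b)"
proof -
  have ite: "(\<Sum>l\<in>UNIV. if P then g l else 0) = (if P then \<Sum>l\<in>UNIV. g l else 0)"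
    for P and g :: "'a \<Rightarrow> complex"
    by simp
  have "(\<Sum>k\<in>UNIV. \<Sum>l\<in>UNIV. C $ k $ l * (axis i a + axis j b) $ k * cnj ((axis i a + axis j b) $ l))
     = C $ i $ i * a * cnj a + C $ i $ j * a * cnj b + C $ j $ i * b * cnj a + C $ j $ j * b * cnj b"
    by (simp add: axis_def algebra_simps sum.distrib if_distrib[of cnj]
        if_distrib[of "\<lambda>a. _ * a"] ite sum.delta sum.delta' cong: if_cong)
  then have "hform C (axis i a + axis j b) = Re (C $ i $ i * a * cnj a) + Re (C $ i $ j * a * cnj b)
      + Re (C $ j $ i * b * cnj a) + Re (C $ j $ j * b * cnj b)"
    by (simp only: hform_def plus_complex.sel)
  moreover have "Re (C $ i $ i * a * cnj a) = (cmod a)\<^sup>2 * Re (C $ i $ i)" for a i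
    by (simp add: mult.assoc complex_mult_cnj cmod_power2)
  moreover have "Re (C $ j $ i * b * cnj a) = Re (cnj (C $ i $ j * a * cnj b))"
    by (simp only: complex_cnj_mult hermitian_cnj[OF C] complex_cnj_cnj mult_ac)
  ultimately show ?thesis by (simp only: cnj.sel)
qed

lemma positive_semidefinite_entry_bound:
  assumes C: "positive_semidefinite C"
  shows "cmod (C $ i $ j) \<le> Re (trace C)"
proof -
  have H: "hermitian C" and P: "\<And>v. 0 \<le> hform C v" using C by (auto simp: positive_semidefinite_iff)
  have diag: "0 \<le> Re (C $ k $ k)" for k
    using P[of "axis k 1 + axis k 0"] unfolding hform_axis_add[OF H] by simp
  have le: "Re (C $ k $ k) \<le> Re (trace C)" for k
    unfolding trace_def Re_sum by (rule member_le_sum) (auto simp: diag)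
  \<comment> \<open>This phase makes the cross term equal to minus twice the modulus of the entry.
    As \<open>sgn 0 = 0\<close>, the modulus of \<open>t\<close> is only bounded by 1, which is
    enough.\<close>
  define t where "t = - sgn (C $ i $ j)"
  have "cmod t \<le> 1" by (simp add: t_def norm_sgn)
  then have "(cmod t)\<^sup>2 \<le> 1" by (simp add: power_le_one)
  then have "(cmod t)\<^sup>2 * Re (C $ j $ j) \<le> Re (C $ j $ j)" using diag by (simp add: mult_left_le_one_le)
  moreover have "C $ i $ j * 1 * cnj t = - of_real (cmod (C $ i $ j))"
  proof -
    have "C $ i $ j * 1 * cnj t = - (C $ i $ j * cnj (C $ i $ j)) / of_real (cmod (C $ i $ j))"
      by (simp add: t_def sgn_eq)
    also have "\<dots> = - of_real (cmod (C $ i $ j))"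
      by (simp add: complex_norm_square[symmetric] power2_eq_square)
    finally show ?thesis .
  qed
  ultimately have "2 * cmod (C $ i $ j) \<le> Re (C $ i $ i) + Re (C $ j $ j)"
    using P[of "axis i 1 + axis j t"] unfolding hform_axis_add[OF H] by simp
  then show ?thesis using le[of i] le[of j] by linarith
qed

subsection \<open>Directional derivatives of smooth functions\<close>

abbreviation dderiv :: "'a::euclidean_space \<Rightarrow> ('a \<Rightarrow> real) \<Rightarrow> 'a \<Rightarrow> real" where
  "dderiv v f \<equiv> \<lambda>x. frechet_derivative f (at x) v"

lemma smooth_differentiable: "smooth f \<Longrightarrow> f differentiable (at x)"
  unfolding smooth_def by (metis times_continuously_differentiable.simps(2))

lemma smooth_dderiv: "smooth f \<Longrightarrow> smooth (dderiv v f)"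
  unfolding smooth_def by (metis times_continuously_differentiable.simps(2))

lemma smooth_continuous: "smooth f \<Longrightarrow> continuous_on UNIV f"
  unfolding smooth_def by (metis times_continuously_differentiable.simps(1))

lemma DERIV_line:
  assumes "smooth f"
  shows "((\<lambda>t. f (x + t *\<^sub>R a)) has_real_derivative dderiv a f (x + t *\<^sub>R a)) (at t)"
proof -
  let ?f' = "frechet_derivative f (at (x + t *\<^sub>R a))"
  have f: "(f has_derivative ?f') (at (x + t *\<^sub>R a))"
    using smooth_differentiable[OF assms] by (simp add: frechet_derivative_works)
  have "((\<lambda>t. x + t *\<^sub>R a) has_derivative (\<lambda>h. h *\<^sub>R a)) (at t)"
    by (auto intro!: derivative_eq_intros)
  then have "((\<lambda>t. f (x + t *\<^sub>R a)) has_derivative (\<lambda>h. ?f' (h *\<^sub>R a))) (at t)"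
    using has_derivative_compose f by blast
  moreover have "?f' (h *\<^sub>R a) = dderiv a f (x + t *\<^sub>R a) * h" for h
    using linear_frechet_derivative[OF smooth_differentiable[OF assms]] by (simp add: linear_cmul)
  ultimately show ?thesis by (simp add: has_field_derivative_def)
qed

lemma dderiv_linear:
  assumes "smooth f"
  shows "linear (\<lambda>v. dderiv v f x)"
  using linear_frechet_derivative[OF smooth_differentiable[OF assms]] by simp

lemma dderiv_Basis:
  assumes "smooth f"
  shows "dderiv v f x = (\<Sum>e\<in>Basis. (v \<bullet> e) * dderiv e f x)"
proof -
  have "dderiv v f x = dderiv (\<Sum>e\<in>Basis. (v \<bullet> e) *\<^sub>R e) f x" by (simp add: euclidean_representation)
  also have "\<dots> = (\<Sum>e\<in>Basis. (v \<bullet> e) * dderiv e f x)"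
    using dderiv_linear[OF assms] by (simp add: linear_sum linear_cmul)
  finally show ?thesis .
qed

text \<open>Both mixed derivatives are values of the same second difference quotient.\<close>

lemma second_difference_mean_value:
  assumes f: "smooth f" and s: "0 < s"
  obtains \<xi> \<eta> where "0 < \<xi>" "\<xi> < s" "0 < \<eta>" "\<eta> < s"
    "f (x + s *\<^sub>R a + s *\<^sub>R b) - f (x + s *\<^sub>R a) - f (x + s *\<^sub>R b) + f x
      = s\<^sup>2 * dderiv b (dderiv a f) (x + \<xi> *\<^sub>R a + \<eta> *\<^sub>R b)"
proof -
  define g where "g = (\<lambda>t. f (x + s *\<^sub>R b + t *\<^sub>R a) - f (x + t *\<^sub>R a))"
  have "(g has_real_derivative (dderiv a f (x + s *\<^sub>R b + t *\<^sub>R a) - dderiv a f (x + t *\<^sub>R a))) (at t)" for t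
    unfolding g_def by (intro DERIV_diff DERIV_line f)
  then obtain \<xi> where \<xi>: "0 < \<xi>" "\<xi> < s"
    "g s - g 0 = (s - 0) * (dderiv a f (x + s *\<^sub>R b + \<xi> *\<^sub>R a) - dderiv a f (x + \<xi> *\<^sub>R a))"
    using MVT2[OF s, of g "\<lambda>t. dderiv a f (x + s *\<^sub>R b + t *\<^sub>R a) - dderiv a f (x + t *\<^sub>R a)"] by blast
  have "((\<lambda>t. dderiv a f ((x + \<xi> *\<^sub>R a) + t *\<^sub>R b)) has_real_derivative
      dderiv b (dderiv a f) ((x + \<xi> *\<^sub>R a) + t *\<^sub>R b)) (at t)" for t
    by (intro DERIV_line smooth_dderiv f)
  then obtain \<eta> where \<eta>: "0 < \<eta>" "\<eta> < s"
    "dderiv a f ((x + \<xi> *\<^sub>R a) + s *\<^sub>R b) - dderiv a f ((x + \<xi> *\<^sub>R a) + 0 *\<^sub>R b)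
      = (s - 0) * dderiv b (dderiv a f) ((x + \<xi> *\<^sub>R a) + \<eta> *\<^sub>R b)"
    using MVT2[OF s, of "\<lambda>t. dderiv a f ((x + \<xi> *\<^sub>R a) + t *\<^sub>R b)"
      "\<lambda>t. dderiv b (dderiv a f) ((x + \<xi> *\<^sub>R a) + t *\<^sub>R b)"] by blast
  show thesis
    using \<xi> \<eta> by (intro that[of \<xi> \<eta>]) (auto simp: g_def algebra_simps power2_eq_square)
qed

lemma dderiv_commute:
  assumes f: "smooth f"
  shows "dderiv a (dderiv b f) x = dderiv b (dderiv a f) x"
proof -
  define P where "P = (\<lambda>y. dderiv b (dderiv a f) y)"
  define Q where "Q = (\<lambda>y. dderiv a (dderiv b f) y)"
  have P: "isCont P x" and Q: "isCont Q x"
    using smooth_continuous[OF smooth_dderiv[OF smooth_dderiv[OF f]]]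
    by (auto simp: P_def Q_def continuous_on_eq_continuous_at)
  \<comment> \<open>For each step size the two orders of differentiation agree, though at different
    nearby points; shrinking the step moves both points to \<open>x\<close>, and continuity does the
    rest.\<close>
  define s where "s = (\<lambda>n. 1 / real (Suc n))"
  have s: "0 < s n" for n by (simp add: s_def)
  have "\<exists>p q r t. 0 < p \<and> p < s n \<and> 0 < q \<and> q < s n \<and> 0 < r \<and> r < s n \<and> 0 < t \<and> t < s n \<and>
      P (x + p *\<^sub>R a + q *\<^sub>R b) = Q (x + r *\<^sub>R b + t *\<^sub>R a)" for n
  proof -
    obtain p q where 1: "0 < p" "p < s n" "0 < q" "q < s n"
      "f (x + s n *\<^sub>R a + s n *\<^sub>R b) - f (x + s n *\<^sub>R a) - f (x + s n *\<^sub>R b) + f x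
        = (s n)\<^sup>2 * P (x + p *\<^sub>R a + q *\<^sub>R b)"
      unfolding P_def using second_difference_mean_value[OF f s] by metis
    obtain r t where 2: "0 < r" "r < s n" "0 < t" "t < s n"
      "f (x + s n *\<^sub>R b + s n *\<^sub>R a) - f (x + s n *\<^sub>R b) - f (x + s n *\<^sub>R a) + f x
        = (s n)\<^sup>2 * Q (x + r *\<^sub>R b + t *\<^sub>R a)"
      unfolding Q_def using second_difference_mean_value[OF f s] by metis
    have "(s n)\<^sup>2 * P (x + p *\<^sub>R a + q *\<^sub>R b) = (s n)\<^sup>2 * Q (x + r *\<^sub>R b + t *\<^sub>R a)"
      using 1(5) 2(5) by (simp add: algebra_simps)
    then show ?thesis using 1(1-4) 2(1-4) s[of n] by (metis mult_cancel_left power_not_zero less_irrefl)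
  qed
  then obtain p q r t where pqrt:
    "\<And>n. 0 < p n \<and> p n < s n" "\<And>n. 0 < q n \<and> q n < s n" "\<And>n. 0 < r n \<and> r n < s n" "\<And>n. 0 < t n \<and> t n < s n"
    "\<And>n. P (x + p n *\<^sub>R a + q n *\<^sub>R b) = Q (x + r n *\<^sub>R b + t n *\<^sub>R a)"
    by metis
  have s0: "s \<longlonglongrightarrow> 0" unfolding s_def by (rule LIMSEQ_Suc) (rule lim_1_over_n)
  have z: "h \<longlonglongrightarrow> 0" if "\<And>n. 0 < h n \<and> h n < s n" for h :: "nat \<Rightarrow> real"
    by (rule tendsto_sandwich[OF _ _ tendsto_const s0]) (use that in \<open>auto intro!: always_eventually less_imp_le\<close>)
  have "(\<lambda>n. x + p n *\<^sub>R a + q n *\<^sub>R b) \<longlonglongrightarrow> x + 0 *\<^sub>R a + 0 *\<^sub>R b"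
    by (intro tendsto_intros z pqrt)
  then have 1: "(\<lambda>n. P (x + p n *\<^sub>R a + q n *\<^sub>R b)) \<longlonglongrightarrow> P x"
    using isCont_tendsto_compose[OF P] by simp
  have "(\<lambda>n. x + r n *\<^sub>R b + t n *\<^sub>R a) \<longlonglongrightarrow> x + 0 *\<^sub>R b + 0 *\<^sub>R a"
    by (intro tendsto_intros z pqrt)
  then have "(\<lambda>n. Q (x + r n *\<^sub>R b + t n *\<^sub>R a)) \<longlonglongrightarrow> Q x"
    using isCont_tendsto_compose[OF Q] by simp
  then have "P x = Q x" using 1 LIMSEQ_unique unfolding pqrt(5) by blast
  then show ?thesis by (simp add: P_def Q_def)
qed

section \<open>The Euler operator and the phase\<close>

definition euler :: "('a::euclidean_space \<Rightarrow> real) \<Rightarrow> 'a \<Rightarrow> real" where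
  "euler f x = dderiv x f x"

lemma euler_gradient: "smooth f \<Longrightarrow> x \<bullet> gradient f x = euler f x"
  by (simp add: euler_def gradient_def inner_sum_right dderiv_Basis[where f = f and v = x and x = x] mult.commute)

lemma continuous_on_euler:
  assumes "smooth f"
  shows "continuous_on UNIV (euler f)"
  unfolding euler_def dderiv_Basis[OF assms, where v = x and x = x for x]
  by (intro continuous_intros smooth_continuous smooth_dderiv assms)

lemma DERIV_euler:
  assumes f: "smooth f"
  shows "((\<lambda>t. euler f (x + t *\<^sub>R a)) has_real_derivative dderiv a f x + euler (dderiv a f) x) (at 0)"
proof -
  have D: "((\<lambda>t. dderiv e f (x + t *\<^sub>R a)) has_real_derivative dderiv e (dderiv a f) x) (at 0)" for e
    using DERIV_line[OF smooth_dderiv[OF f], of x a e 0] by (simp add: dderiv_commute[OF f, where a = e and b = a])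
  have L: "((\<lambda>t. (x + t *\<^sub>R a) \<bullet> e) has_real_derivative a \<bullet> e) (at 0)" for e
    by (auto intro!: derivative_eq_intros simp: inner_add_left)
  have "((\<lambda>t. \<Sum>e\<in>Basis. ((x + t *\<^sub>R a) \<bullet> e) * dderiv e f (x + t *\<^sub>R a)) has_real_derivative
      (\<Sum>e\<in>Basis. (a \<bullet> e) * dderiv e f (x + 0 *\<^sub>R a)
         + dderiv e (dderiv a f) x * ((x + 0 *\<^sub>R a) \<bullet> e))) (at 0)"
    by (intro DERIV_sum DERIV_mult D L)
  moreover have "(\<Sum>e\<in>Basis. (a \<bullet> e) * dderiv e f (x + 0 *\<^sub>R a)
         + dderiv e (dderiv a f) x * ((x + 0 *\<^sub>R a) \<bullet> e)) = dderiv a f x + euler (dderiv a f) x"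
    unfolding euler_def dderiv_Basis[OF f, where v = a and x = x]
      dderiv_Basis[OF smooth_dderiv[OF f], where v = x and x = x]
    by (simp add: sum.distrib mult.commute)
  ultimately show ?thesis
    unfolding euler_def dderiv_Basis[OF f, where v = "x + t *\<^sub>R a" for t] by simp
qed

definition shrinker_phase :: "('a::euclidean_space \<Rightarrow> real) \<Rightarrow> 'a \<Rightarrow> real" where
  "shrinker_phase u x = 1 / 2 * euler u x - u x"

text \<open>By \<open>DERIV_euler\<close>, moving \<open>dderiv a\<close> past \<open>euler\<close>
  costs one extra \<open>dderiv a\<close>. The phase vanishes on functions homogeneous of degree 2,
  whose second derivatives have degree 0; accordingly a bare Euler operator is all that remains
  after two steps.\<close>

lemma directional_derivatives_shrinker_phase:
  assumes u: "smooth u"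
  shows "directional_derivatives (shrinker_phase u)
    (\<lambda>x a. 1 / 2 * (euler (dderiv a u) x - dderiv a u x)) (\<lambda>x a. 1 / 2 * euler (dderiv a (dderiv a u)) x)"
  unfolding directional_derivatives_def
proof (intro allI conjI)
  fix x a :: 'a
  have L: "((\<lambda>t. f (x + t *\<^sub>R a)) has_real_derivative dderiv a f x) (at 0)" if "smooth f" for f
    using DERIV_line[OF that, of x a 0] by simp
  note v = smooth_dderiv[OF u, of a]
  have "((\<lambda>t. 1 / 2 * euler u (x + t *\<^sub>R a) - u (x + t *\<^sub>R a)) has_real_derivative
      1 / 2 * (dderiv a u x + euler (dderiv a u) x) - dderiv a u x) (at 0)"
    by (intro DERIV_diff DERIV_cmult DERIV_euler L u)
  then show "((\<lambda>t. shrinker_phase u (x + t *\<^sub>R a)) has_real_derivative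
      1 / 2 * (euler (dderiv a u) x - dderiv a u x)) (at 0)"
    unfolding shrinker_phase_def by (rule DERIV_cong) (simp add: field_simps)
  have "((\<lambda>t. 1 / 2 * (euler (dderiv a u) (x + t *\<^sub>R a) - dderiv a u (x + t *\<^sub>R a))) has_real_derivative
      1 / 2 * ((dderiv a (dderiv a u) x + euler (dderiv a (dderiv a u)) x) - dderiv a (dderiv a u) x)) (at 0)"
    by (intro DERIV_diff DERIV_cmult DERIV_euler L v)
  then show "((\<lambda>t. 1 / 2 * (euler (dderiv a u) (x + t *\<^sub>R a) - dderiv a u (x + t *\<^sub>R a))) has_real_derivative
      1 / 2 * euler (dderiv a (dderiv a u)) x) (at 0)"
    by simp
qed

text \<open>On a ray the derivative at parameter \<open>t\<close> is the Euler derivative divided by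
  \<open>t\<close>, so \<open>g\<close> is constant for positive \<open>t\<close>; continuity at the
  origin ties all rays to the same value.\<close>

lemma euler_zero_imp_constant:
  assumes g: "smooth g" and z: "\<And>x. euler g x = 0"
  shows "g x = g 0"
proof -
  have D: "((\<lambda>t. g (0 + t *\<^sub>R x)) has_real_derivative dderiv x g (0 + t *\<^sub>R x)) (at t)" for t
    by (rule DERIV_line[OF g])
  have "g (0 + 1 *\<^sub>R x) = g (0 + 0 *\<^sub>R x)"
  proof (rule DERIV_isconst_end[of 0 1 "\<lambda>t. g (0 + t *\<^sub>R x)"])
    show "continuous_on {0..1} (\<lambda>t. g (0 + t *\<^sub>R x))"
      using D by (intro continuous_at_imp_continuous_on) (blast intro: DERIV_isCont)
    fix t :: real assume t: "0 < t" "t < 1"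
    have "t * dderiv x g (t *\<^sub>R x) = euler g (t *\<^sub>R x)"
      using dderiv_linear[OF g] by (simp add: euler_def linear_cmul)
    then have "dderiv x g (t *\<^sub>R x) = 0" using z t by simp
    then show "((\<lambda>t. g (0 + t *\<^sub>R x)) has_real_derivative 0) (at t)" using D[of t] by simp
  qed simp
  then show ?thesis by simp
qed

text \<open>The Taylor expansion of order 2 is exact along every line through the origin, and its
  quadratic term is then expanded bilinearly in the basis.\<close>

lemma quadratic_if_second_derivatives_constant:
  assumes u: "smooth u" and c: "\<And>a x. dderiv a (dderiv a u) x = dderiv a (dderiv a u) 0"
  shows "quadratic_polynomial u"
proof -
  have taylor: "u x = u 0 + dderiv x u 0 + 1 / 2 * dderiv x (dderiv x u) 0" for x
  proof -
    define q where "q = dderiv x (dderiv x u) 0"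
    define h where "h = (\<lambda>t. dderiv x u (0 + t *\<^sub>R x) - q * t)"
    have "(h has_real_derivative dderiv x (dderiv x u) (0 + t *\<^sub>R x) - q * 1) (at t)" for t
      unfolding h_def by (intro DERIV_diff DERIV_line smooth_dderiv u DERIV_cmult DERIV_ident)
    moreover have "dderiv x (dderiv x u) (0 + t *\<^sub>R x) - q * 1 = 0" for t
      using c[of x "t *\<^sub>R x"] by (simp add: q_def)
    ultimately have "(h has_real_derivative 0) (at t)" for t by metis
    then have h: "h t = h 0" for t using DERIV_isconst_all by blast
    define k where "k = (\<lambda>t. u (0 + t *\<^sub>R x) - (h 0 * t + q * (t\<^sup>2 / 2)))"
    have "(k has_real_derivative dderiv x u (0 + t *\<^sub>R x) - (h 0 * 1 + q * t)) (at t)" for t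
      unfolding k_def
      by (intro DERIV_diff DERIV_add DERIV_line u DERIV_cmult DERIV_ident) (auto intro!: derivative_eq_intros)
    moreover have "dderiv x u (0 + t *\<^sub>R x) - (h 0 * 1 + q * t) = 0" for t
      using h[of t] by (simp add: h_def)
    ultimately have "(k has_real_derivative 0) (at t)" for t by metis
    then have "k 1 = k 0" using DERIV_isconst_all by blast
    then show ?thesis by (simp add: k_def h_def q_def)
  qed
  have "dderiv x (dderiv x u) 0 = (\<Sum>e\<in>Basis. \<Sum>f\<in>Basis. dderiv f (dderiv e u) 0 * (x \<bullet> e) * (x \<bullet> f))" for x
  proof -
    have "dderiv x (dderiv x u) 0 = (\<Sum>e\<in>Basis. (x \<bullet> e) * dderiv e (dderiv x u) 0)"
      by (rule dderiv_Basis[OF smooth_dderiv[OF u]])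
    also have "\<dots> = (\<Sum>e\<in>Basis. (x \<bullet> e) * (\<Sum>f\<in>Basis. (x \<bullet> f) * dderiv f (dderiv e u) 0))"
      by (simp only: dderiv_commute[OF u, where b = x] dderiv_Basis[OF smooth_dderiv[OF u], where v = x])
    finally show ?thesis by (simp add: sum_distrib_left mult_ac)
  qed
  then have "u x = u 0 + (\<Sum>e\<in>Basis. dderiv e u 0 * (x \<bullet> e))
      + (\<Sum>e\<in>Basis. \<Sum>f\<in>Basis. (1 / 2 * dderiv f (dderiv e u) 0) * (x \<bullet> e) * (x \<bullet> f))" for x
    using taylor[of x] by (simp add: dderiv_Basis[OF u, where v = x and x = 0] sum_distrib_left mult_ac)
  then show ?thesis
    unfolding quadratic_polynomial_def
    by (intro exI[of _ "u 0"] exI[of _ "\<lambda>e. dderiv e u 0"]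
        exI[of _ "\<lambda>e f. 1 / 2 * dderiv f (dderiv e u) 0"] allI)
qed

subsection \<open>The complex Hessian\<close>

lemma complex_hessian_entry:
  fixes u :: "complex^'n \<Rightarrow> real"
  assumes u: "smooth u"
  shows "complex_hessian u z $ i $ j = 1 / 4 *
    (of_real (dderiv (axis i 1) (dderiv (axis j 1) u) z + dderiv (axis i \<i>) (dderiv (axis j \<i>) u) z)
     + \<i> * of_real (dderiv (axis i 1) (dderiv (axis j \<i>) u) z - dderiv (axis i \<i>) (dderiv (axis j 1) u) z))"
proof -
  have D: "((\<lambda>w. complex_of_real (f w)) has_derivative (\<lambda>v. of_real (dderiv v f z))) (at z)"
    if "smooth f" for f :: "complex^'n \<Rightarrow> real" and z
    using smooth_differentiable[OF that] by (intro has_derivative_of_real) (simp add: frechet_derivative_works)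
  have "frechet_derivative (\<lambda>w. complex_of_real (u w)) (at z) = (\<lambda>v. of_real (dderiv v u z))" for z
    using frechet_derivative_at[OF D[OF u]] by simp
  then have zbar: "d_zbar j (\<lambda>w. complex_of_real (u w))
      = (\<lambda>z. 1 / 2 * (of_real (dderiv (axis j 1) u z) + \<i> * of_real (dderiv (axis j \<i>) u z)))"
    by (simp add: d_zbar_def fun_eq_iff)
  have "(d_zbar j (\<lambda>w. complex_of_real (u w)) has_derivative
      (\<lambda>v. 1 / 2 * (of_real (dderiv v (dderiv (axis j 1) u) z) + \<i> * of_real (dderiv v (dderiv (axis j \<i>) u) z)))) (at z)"
    unfolding zbar by (intro has_derivative_mult_right has_derivative_add D smooth_dderiv u)
  then have "frechet_derivative (d_zbar j (\<lambda>w. complex_of_real (u w))) (at z) =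
      (\<lambda>v. 1 / 2 * (of_real (dderiv v (dderiv (axis j 1) u) z) + \<i> * of_real (dderiv v (dderiv (axis j \<i>) u) z)))"
    by (rule frechet_derivative_at[symmetric])
  then show ?thesis
    by (simp add: complex_hessian_def d_z_def complex_eq_iff field_simps)
qed

lemma complex_vector_expansion:
  fixes v :: "complex^'n"
  shows "v = (\<Sum>i\<in>UNIV. Re (v $ i) *\<^sub>R axis i 1 + Im (v $ i) *\<^sub>R axis i \<i>)"
proof -
  have "(\<Sum>i\<in>UNIV. Re (v $ i) *\<^sub>R axis i 1 + Im (v $ i) *\<^sub>R axis i \<i>) $ k = v $ k" for k
  proof -
    have "(\<Sum>i\<in>UNIV. Re (v $ i) *\<^sub>R axis i 1 + Im (v $ i) *\<^sub>R axis i \<i>) $ k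
        = (\<Sum>i\<in>UNIV. if i = k then v $ i else 0)"
      unfolding sum_component by (rule sum.cong) (auto simp: axis_def complex_eq_iff)
    then show ?thesis by simp
  qed
  then show ?thesis by (simp add: vec_eq_iff)
qed

lemma dderiv_complex:
  fixes f :: "complex^'n \<Rightarrow> real"
  assumes "smooth f"
  shows "dderiv v f z = (\<Sum>i\<in>UNIV. Re (v $ i) * dderiv (axis i 1) f z + Im (v $ i) * dderiv (axis i \<i>) f z)"
proof -
  have "dderiv v f z = dderiv (\<Sum>i\<in>UNIV. Re (v $ i) *\<^sub>R axis i 1 + Im (v $ i) *\<^sub>R axis i \<i>) f z"
    by (simp only: complex_vector_expansion[symmetric])
  then show ?thesis
    using dderiv_linear[OF assms, of z] by (simp add: linear_sum linear_add linear_cmul)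
qed

lemma dderiv_dderiv_complex:
  fixes u :: "complex^'n \<Rightarrow> real"
  assumes u: "smooth u"
  shows "dderiv v (dderiv v u) z = (\<Sum>i\<in>UNIV. \<Sum>j\<in>UNIV.
      Re (v $ i) * Re (v $ j) * dderiv (axis i 1) (dderiv (axis j 1) u) z
    + Re (v $ i) * Im (v $ j) * dderiv (axis i 1) (dderiv (axis j \<i>) u) z
    + Im (v $ i) * Re (v $ j) * dderiv (axis i \<i>) (dderiv (axis j 1) u) z
    + Im (v $ i) * Im (v $ j) * dderiv (axis i \<i>) (dderiv (axis j \<i>) u) z)"
proof -
  have e: "dderiv a (dderiv v u) z
      = (\<Sum>j\<in>UNIV. Re (v $ j) * dderiv a (dderiv (axis j 1) u) z + Im (v $ j) * dderiv a (dderiv (axis j \<i>) u) z)" for a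
    unfolding dderiv_commute[OF u, where b = v and x = z] dderiv_complex[OF smooth_dderiv[OF u], where v = v and z = z]
    by (simp only: dderiv_commute[OF u, where b = a])
  have "dderiv v (dderiv v u) z
      = (\<Sum>i\<in>UNIV. Re (v $ i) * dderiv (axis i 1) (dderiv v u) z + Im (v $ i) * dderiv (axis i \<i>) (dderiv v u) z)"
    by (rule dderiv_complex[OF smooth_dderiv[OF u]])
  also have "\<dots> = (\<Sum>i\<in>UNIV. \<Sum>j\<in>UNIV.
      Re (v $ i) * (Re (v $ j) * dderiv (axis i 1) (dderiv (axis j 1) u) z + Im (v $ j) * dderiv (axis i 1) (dderiv (axis j \<i>) u) z)
    + Im (v $ i) * (Re (v $ j) * dderiv (axis i \<i>) (dderiv (axis j 1) u) z + Im (v $ j) * dderiv (axis i \<i>) (dderiv (axis j \<i>) u) z))"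
    unfolding e sum_distrib_left sum.distrib[symmetric] ..
  also have "\<dots> = (\<Sum>i\<in>UNIV. \<Sum>j\<in>UNIV.
      Re (v $ i) * Re (v $ j) * dderiv (axis i 1) (dderiv (axis j 1) u) z
    + Re (v $ i) * Im (v $ j) * dderiv (axis i 1) (dderiv (axis j \<i>) u) z
    + Im (v $ i) * Re (v $ j) * dderiv (axis i \<i>) (dderiv (axis j 1) u) z
    + Im (v $ i) * Im (v $ j) * dderiv (axis i \<i>) (dderiv (axis j \<i>) u) z)"
    by (intro sum.cong refl) (simp add: algebra_simps)
  finally show ?thesis .
qed

text \<open>This is the Levi form: a quarter of the Laplacian of \<open>u\<close> along the complex
  line through \<open>z\<close> in direction \<open>v\<close>.\<close>

lemma hform_complex_hessian:
  fixes u :: "complex^'n \<Rightarrow> real"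
  assumes u: "smooth u"
  shows "hform (complex_hessian u z) v
    = 1 / 4 * (dderiv v (dderiv v u) z + dderiv (\<i> *s v) (dderiv (\<i> *s v) u) z)"
proof -
  have "hform (complex_hessian u z) v
      = (\<Sum>i\<in>UNIV. \<Sum>j\<in>UNIV. Re (complex_hessian u z $ i $ j * v $ i * cnj (v $ j)))"
    by (simp only: hform_def Re_sum)
  also have "\<dots> = 1 / 4 * (dderiv v (dderiv v u) z + dderiv (\<i> *s v) (dderiv (\<i> *s v) u) z)"
    unfolding dderiv_dderiv_complex[OF u] sum.distrib[symmetric] sum_distrib_left
    by (intro sum.cong refl) (simp add: complex_hessian_entry[OF u] field_simps)
  finally show ?thesis .
qed

lemma continuous_complex_hessian:
  assumes "smooth u"
  shows "continuous_on UNIV (\<lambda>z. complex_hessian u z $ i $ j)"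
proof -
  have "continuous_on UNIV (dderiv a (dderiv b u))" for a b
    by (intro smooth_continuous smooth_dderiv assms)
  then show ?thesis
    unfolding complex_hessian_entry[OF assms] by (intro continuous_intros)
qed

section \<open>Size and ellipticity of the coefficients\<close>

lemma inner_square_add_i_square:
  fixes v w :: "complex^'n"
  shows "(w \<bullet> v)\<^sup>2 + (w \<bullet> (\<i> *s v))\<^sup>2 = (cmod (\<Sum>i\<in>UNIV. w $ i * cnj (v $ i)))\<^sup>2"
proof -
  define s where "s = (\<Sum>i\<in>UNIV. w $ i * cnj (v $ i))"
  have "w \<bullet> v = Re s"
    unfolding s_def inner_vec_def Re_sum by (intro sum.cong refl) (simp add: inner_complex_def)
  moreover have "w \<bullet> (\<i> *s v) = Im s"
    unfolding s_def inner_vec_def Im_sum by (intro sum.cong refl) (simp add: inner_complex_def)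
  ultimately show ?thesis by (simp add: s_def[symmetric] cmod_power2)
qed

text \<open>With \<open>z = w v* C\<close> one recovers \<open>w = z v* A\<close>, and
  Cauchy-Schwarz bounds this by the Frobenius norm of \<open>A\<close> times the norm of
  \<open>z\<close>.\<close>

lemma hermitian_inverse_lower_bound:
  fixes A C :: "complex^'n^'n" and w :: "complex^'n"
  assumes C: "hermitian C" and CA: "C ** A = mat 1"
  shows "w \<bullet> w \<le> (\<Sum>i\<in>UNIV. \<Sum>j\<in>UNIV. (cmod (A $ i $ j))\<^sup>2)
    * (\<Sum>k\<in>UNIV. (cmod (\<Sum>i\<in>UNIV. w $ i * cnj (C $ k $ i)))\<^sup>2)"
proof -
  define z where "z = w v* C"
  have zk: "(\<Sum>i\<in>UNIV. w $ i * cnj (C $ k $ i)) = z $ k" for k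
    by (simp add: z_def vector_matrix_mult_def hermitian_cnj[OF C] mult.commute)
  have wz: "w = z v* A" by (simp add: z_def vector_matrix_mul_assoc CA)
  have "(cmod (w $ j))\<^sup>2 \<le> (\<Sum>i\<in>UNIV. (cmod (z $ i))\<^sup>2) * (\<Sum>i\<in>UNIV. (cmod (A $ i $ j))\<^sup>2)" for j
  proof -
    have "cmod (w $ j) \<le> (\<Sum>i\<in>UNIV. cmod (z $ i) * cmod (A $ i $ j))"
      by (subst wz) (auto simp: vector_matrix_mult_def norm_mult mult.commute intro!: sum_norm_le)
    then have "(cmod (w $ j))\<^sup>2 \<le> (\<Sum>i\<in>UNIV. cmod (z $ i) * cmod (A $ i $ j))\<^sup>2"
      by (rule power_mono) simp
    also have "\<dots> \<le> (\<Sum>i\<in>UNIV. (cmod (z $ i))\<^sup>2) * (\<Sum>i\<in>UNIV. (cmod (A $ i $ j))\<^sup>2)"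
      by (rule Cauchy_Schwarz_ineq_sum)
    finally show ?thesis .
  qed
  then have "(\<Sum>j\<in>UNIV. (cmod (w $ j))\<^sup>2)
      \<le> (\<Sum>j\<in>UNIV. (\<Sum>i\<in>UNIV. (cmod (z $ i))\<^sup>2) * (\<Sum>i\<in>UNIV. (cmod (A $ i $ j))\<^sup>2))"
    by (rule sum_mono)
  also have "\<dots> = (\<Sum>i\<in>UNIV. (cmod (z $ i))\<^sup>2) * (\<Sum>i\<in>UNIV. \<Sum>j\<in>UNIV. (cmod (A $ i $ j))\<^sup>2)"
    unfolding sum_distrib_left[symmetric] by (subst sum.swap) (rule refl)
  finally show ?thesis
    unfolding zk inner_vec_def by (simp add: power2_norm_eq_inner mult.commute)
qed

lemma positive_semidefinite_rows_bound:
  fixes C :: "complex^'n^'n"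
  assumes C: "positive_semidefinite C"
  shows "(\<Sum>k\<in>UNIV. C $ k \<bullet> C $ k) \<le> (real CARD('n))\<^sup>2 * (Re (trace C))\<^sup>2"
proof -
  have "C $ k \<bullet> C $ k = (\<Sum>j\<in>UNIV. (cmod (C $ k $ j))\<^sup>2)" for k
    by (simp add: inner_vec_def power2_norm_eq_inner)
  then have "(\<Sum>k\<in>UNIV. C $ k \<bullet> C $ k) = (\<Sum>k\<in>UNIV. \<Sum>j\<in>UNIV. (cmod (C $ k $ j))\<^sup>2)" by simp
  also have "\<dots> \<le> (\<Sum>k\<in>(UNIV :: 'n set). \<Sum>j\<in>(UNIV :: 'n set). (Re (trace C))\<^sup>2)"
    by (intro sum_mono power_mono positive_semidefinite_entry_bound C) simp
  also have "\<dots> = (real CARD('n))\<^sup>2 * (Re (trace C))\<^sup>2"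
    by (simp add: power2_eq_square)
  finally show ?thesis .
qed

theorem theorem1p1:
  fixes u :: "complex ^ 'n \<Rightarrow> real"
  assumes "smooth u"
    and "plurisubharmonic u"
    and "self_shrinking_J_equation u"
  shows "quadratic_polynomial u"
proof -
  note u = assms(1)
  define H where "H = complex_hessian u"
  define \<phi> where "\<phi> = shrinker_phase u"
  have H: "positive_semidefinite (H x)" for x
    using assms(2) by (simp add: plurisubharmonic_def H_def)
  have "\<exists>C. H x ** C = mat 1 \<and> Re (trace C) = - \<phi> x" for x
  proof -
    have nz: "\<forall>\<mu>\<in>#eigenvalues (H x). \<mu> \<noteq> 0"
      and eq: "- (\<Sum>\<mu>\<in>#eigenvalues (H x). 1 / \<mu>) = complex_of_real (\<phi> x)"
      using assms(3) euler_gradient[OF u]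
      by (auto simp: self_shrinking_J_equation_def H_def \<phi>_def shrinker_phase_def)
    obtain C where C: "H x ** C = mat 1" "(\<Sum>\<mu>\<in>#eigenvalues (H x). 1 / \<mu>) = trace C"
      using sum_inverse_eigenvalues[OF nz] .
    have "- trace C = complex_of_real (\<phi> x)" using eq unfolding C(2) .
    then have "Re (- trace C) = \<phi> x" by (simp only: Re_complex_of_real)
    then show ?thesis using C(1) by auto
  qed
  then obtain C where HC: "\<And>x. H x ** C x = mat 1" and tr: "\<And>x. Re (trace (C x)) = - \<phi> x"
    by metis
  have C: "positive_semidefinite (C x)" for x by (rule positive_semidefinite_inverse[OF H HC])
  then have herm: "hermitian (C x)" for x by (simp add: positive_semidefinite_iff)
  have CH: "C x ** H x = mat 1" for x using HC matrix_left_right_inverse by blast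
  \<comment> \<open>Each row of the inverse gives two real directions, because the Levi form sums
    the second derivatives along \<open>v\<close> and \<open>\<i> *s v\<close>.\<close>
  define c where "c = (\<lambda>x (k, b). if b then \<i> *s C x $ k else C x $ k)"
  have sum_c: "(\<Sum>p\<in>UNIV. g (c x p)) = (\<Sum>k\<in>UNIV. g (C x $ k) + g (\<i> *s C x $ k))"
    for g :: "complex^'n \<Rightarrow> real" and x
    by (simp add: UNIV_Times_UNIV[symmetric] sum.cartesian_product' c_def UNIV_bool add.commute
        del: UNIV_Times_UNIV)
  define \<phi>1 where "\<phi>1 = (\<lambda>x a. 1 / 2 * (euler (dderiv a u) x - dderiv a u x))"
  define \<phi>2 where "\<phi>2 = (\<lambda>x a. 1 / 2 * euler (dderiv a (dderiv a u)) x)"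
  have dd: "directional_derivatives \<phi> \<phi>1 \<phi>2"
    unfolding \<phi>_def \<phi>1_def \<phi>2_def by (rule directional_derivatives_shrinker_phase[OF u])
  have linearised: "(\<Sum>p\<in>UNIV. \<phi>2 x (c x p)) = 2 * \<phi>1 x x" for x
  proof -
    \<comment> \<open>With \<open>C x\<close> frozen, \<open>G\<close> depends on \<open>y\<close>
      only through \<open>H y\<close>, and linearly. Up to a constant it is the tangent of the
      concave function at \<open>H x\<close>, so \<open>\<phi> - G\<close> is maximal at
      \<open>x\<close>.\<close>
    define G where "G = (\<lambda>y. \<Sum>k\<in>UNIV. hform (H y) (C x $ k))"
    have touch: "\<phi> y - G y \<le> \<phi> x - G x" for y
      using trace_inverse_tangent[OF H HC[of y] herm[of x]] trace_inverse_tangent_eq[OF HC[of x] herm[of x]]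
      by (simp add: G_def tr)
    have D: "((\<lambda>t. dderiv a (dderiv a u) (x + t *\<^sub>R x)) has_real_derivative 2 * \<phi>2 x a) (at 0)" for a
      using DERIV_line[OF smooth_dderiv[OF smooth_dderiv[OF u, of a], of a], of x x 0] by (simp add: \<phi>2_def euler_def)
    have G: "((\<lambda>t. G (x + t *\<^sub>R x)) has_real_derivative
        (\<Sum>k\<in>UNIV. 1 / 4 * (2 * \<phi>2 x (C x $ k) + 2 * \<phi>2 x (\<i> *s C x $ k)))) (at 0)"
      unfolding G_def H_def hform_complex_hessian[OF u]
      by (intro DERIV_sum DERIV_cmult DERIV_add D)
    have "((\<lambda>t. \<phi> (x + t *\<^sub>R x)) has_real_derivative \<phi>1 x x) (at 0)"
      using dd unfolding directional_derivatives_def by blast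
    then have "((\<lambda>t. \<phi> (x + t *\<^sub>R x) - G (x + t *\<^sub>R x)) has_real_derivative
        \<phi>1 x x - (\<Sum>k\<in>UNIV. 1 / 4 * (2 * \<phi>2 x (C x $ k) + 2 * \<phi>2 x (\<i> *s C x $ k)))) (at 0)"
      using G by (rule DERIV_diff)
    then have "\<phi>1 x x - (\<Sum>k\<in>UNIV. 1 / 4 * (2 * \<phi>2 x (C x $ k) + 2 * \<phi>2 x (\<i> *s C x $ k))) = 0"
      by (rule DERIV_local_max[of _ _ _ 1]) (use touch in auto)
    moreover have "(\<Sum>k\<in>UNIV. 1 / 4 * (2 * \<phi>2 x (C x $ k) + 2 * \<phi>2 x (\<i> *s C x $ k)))
        = 1 / 2 * (\<Sum>k\<in>UNIV. \<phi>2 x (C x $ k) + \<phi>2 x (\<i> *s C x $ k))"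
      unfolding sum_distrib_left by (intro sum.cong refl) simp
    ultimately show ?thesis unfolding sum_c[of "\<phi>2 x" x] by linarith
  qed
  \<comment> \<open>Each entry of the inverse is bounded by its trace \<open>- \<phi> x\<close>, and
    there are \<open>CARD('n)\<close> squared entries; the factor 2 comes from the multiples by
    \<open>\<i>\<close>. The ellipticity bound is the squared Frobenius norm of
    \<open>H x\<close>.\<close>
  interpret drift_equation \<phi> \<phi>1 \<phi>2 UNIV c "2 * (real CARD('n))\<^sup>2"
    "\<lambda>x. \<Sum>i\<in>UNIV. \<Sum>j\<in>UNIV. (cmod (H x $ i $ j))\<^sup>2"
  proof
    show "directional_derivatives \<phi> \<phi>1 \<phi>2" by fact
    show "continuous_on UNIV \<phi>"
      unfolding \<phi>_def shrinker_phase_def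
      by (intro continuous_intros continuous_on_euler smooth_continuous u)
    show "continuous_on UNIV (\<lambda>x. \<Sum>i\<in>UNIV. \<Sum>j\<in>UNIV. (cmod (H x $ i $ j))\<^sup>2)"
      unfolding H_def by (intro continuous_intros continuous_complex_hessian u)
    fix x :: "complex^'n"
    show "\<phi> x \<le> 0"
      using order_trans[OF norm_ge_zero positive_semidefinite_entry_bound[OF C[of x]]] tr[of x] by simp
    show "(\<Sum>p\<in>UNIV. \<phi>2 x (c x p)) = 2 * \<phi>1 x x" by (rule linearised)
    have ii: "(\<i> *s v) \<bullet> (\<i> *s v) = v \<bullet> v" for v :: "complex^'n"
      by (simp add: inner_vec_def inner_complex_def add.commute)
    show "(\<Sum>p\<in>UNIV. c x p \<bullet> c x p) \<le> 2 * (real CARD('n))\<^sup>2 * (\<phi> x)\<^sup>2"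
      unfolding sum_c[of "\<lambda>v. v \<bullet> v" x]
      using positive_semidefinite_rows_bound[OF C[of x]] by (simp add: ii tr sum_distrib_left[symmetric])
    fix w :: "complex^'n"
    show "w \<bullet> w \<le> (\<Sum>i\<in>UNIV. \<Sum>j\<in>UNIV. (cmod (H x $ i $ j))\<^sup>2) * (\<Sum>p\<in>UNIV. (w \<bullet> c x p)\<^sup>2)"
      unfolding sum_c[of "\<lambda>v. (w \<bullet> v)\<^sup>2" x] inner_square_add_i_square
      by (rule hermitian_inverse_lower_bound[OF herm CH])
  qed
  obtain m where m: "\<And>x. \<phi> x = m" using liouville by blast
  \<comment> \<open>A constant phase has vanishing second derivatives, and these are half the Euler
    derivatives of the second derivatives of \<open>u\<close>.\<close>
  have zero: "\<phi>2 x a = 0" for x a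
  proof -
    have "((\<lambda>t. \<phi> (y + t *\<^sub>R a)) has_real_derivative \<phi>1 y a) (at 0)" for y
      using dd unfolding directional_derivatives_def by blast
    then have "\<phi>1 y a = 0" for y
      using DERIV_unique[OF _ DERIV_const] unfolding m by blast
    moreover have "((\<lambda>t. \<phi>1 (x + t *\<^sub>R a) a) has_real_derivative \<phi>2 x a) (at 0)"
      using dd unfolding directional_derivatives_def by blast
    ultimately show ?thesis using DERIV_unique[OF _ DERIV_const] by simp
  qed
  show ?thesis
  proof (rule quadratic_if_second_derivatives_constant[OF u])
    fix a x
    show "dderiv a (dderiv a u) x = dderiv a (dderiv a u) 0"
    proof (rule euler_zero_imp_constant)
      show "smooth (dderiv a (dderiv a u))" by (intro smooth_dderiv u)
      show "euler (dderiv a (dderiv a u)) y = 0" for y using zero[of y a] by (simp add: \<phi>2_def)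
    qed
  qed
qed

end
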